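(* Let $n=2$ and $d\geq 2$, and work in the polynomial ring $\mathbb C[u_{d0},u_{(d-1)1},\dots,u_{0d}]$ (coordinates on $S^d(\mathbb C^2)$). For $y,v\in\mathbb Z_{\geq0}^2$ with $y_1+y_2=v_1+v_2=d-1$, $y_2\geq1$, $v_1\geq1$, let $$f_{y,v}=u_{y+e_1}u_{v+e_1}-u_{y+2e_1-e_2}u_{v+e_2}+u_{y+e_2}u_{v+e_2}-u_{y+e_1}u_{v-e_1+2e_2},$$ and let $I$ be the ideal generated by all such $f_{y,v}$. Let $\prec$ be the term order given by the weights $\mathrm{weight}(u_{i(d-i)})=i$, $i=0,\dots,d$, with ties broken by the lexicographic order with $u_{d0}\succ u_{(d-1)1}\succ\dots\succ u_{0d}$. Then the polynomials $f_{y,v}$ form a Gröbner basis of $I$ with respect to $\prec$, the variety $\mathcal V(I)\subseteq S^d(\mathbb C^2)$ has dimension $3=\binom{2+1}{2}$, and $I$ is the prime ideal of the odeco variety in $S^d(\mathbb C^2)$.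
   Context: For $T\in S^d(\mathbb C^2)$ and $a=(a_1,a_2)\in\mathbb Z_{\geq0}^2$ with $a_1+a_2=d$, $u_{a}=u_{a_1a_2}=d!\,T_{1\dots1\,2\dots2}$ (index $1$ repeated $a_1$ times, index $2$ repeated $a_2$ times); $e_1,e_2$ are the standard basis vectors. A real tensor $T\in S^d(\mathbb R^2)$ is odeco if $T=\lambda_1v_1^{\otimes d}+\lambda_2v_2^{\otimes d}$ with $v_1,v_2$ an orthonormal basis of $\mathbb R^2$ and $\lambda_1,\lambda_2\in\mathbb R$; the odeco variety is the Zariski closure in $S^d(\mathbb C^2)$ of the set of odeco tensors. *)

theory Defs
  imports Complex_Main "HOL-Library.Poly_Mapping"
begin

(* Multivariate polynomials over the complex numbers in variables u_0, u_1, ...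
  (variable index i stands for the coordinate u_{i(d-i)} of S^d(C^2)).
  A monomial is a finitely supported exponent vector nat \<Rightarrow>\<^sub>0 nat. *)

type_synonym monom = "nat \<Rightarrow>\<^sub>0 nat"
type_synonym mpoly = "monom \<Rightarrow>\<^sub>0 complex"

definition Var :: "nat \<Rightarrow> mpoly" where
  "Var i = Poly_Mapping.single (Poly_Mapping.single i 1) 1"

definition eval_monom :: "monom \<Rightarrow> (nat \<Rightarrow> complex) \<Rightarrow> complex" where
  "eval_monom m x = (\<Prod>i\<in>Poly_Mapping.keys m. x i ^ Poly_Mapping.lookup m i)"

definition eval_mpoly :: "mpoly \<Rightarrow> (nat \<Rightarrow> complex) \<Rightarrow> complex" where
  "eval_mpoly p x = (\<Sum>m\<in>Poly_Mapping.keys p. Poly_Mapping.lookup p m * eval_monom m x)"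

definition polyring :: "nat \<Rightarrow> mpoly set" where
  "polyring d = {p. \<forall>m\<in>Poly_Mapping.keys p. \<forall>i\<in>Poly_Mapping.keys m. i \<le> d}"

definition is_ideal_in :: "mpoly set \<Rightarrow> mpoly set \<Rightarrow> bool" where
  "is_ideal_in R J \<longleftrightarrow> J \<subseteq> R \<and> 0 \<in> J \<and> (\<forall>a\<in>J. \<forall>b\<in>J. a + b \<in> J)
     \<and> (\<forall>r\<in>R. \<forall>a\<in>J. r * a \<in> J)"

definition ideal_gen :: "nat \<Rightarrow> mpoly set \<Rightarrow> mpoly set" where
  "ideal_gen d S = \<Inter>{J. is_ideal_in (polyring d) J \<and> S \<subseteq> J}"

definition prime_ideal :: "nat \<Rightarrow> mpoly set \<Rightarrow> bool" where
  "prime_ideal d J \<longleftrightarrow> is_ideal_in (polyring d) J \<and> J \<noteq> polyring d \<and>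
     (\<forall>f\<in>polyring d. \<forall>g\<in>polyring d. f * g \<in> J \<longrightarrow> f \<in> J \<or> g \<in> J)"

(* Coordinate u_a for a = (a1,a2) with a1 + a2 = d is the variable with index a1. *)
definition u :: "nat \<times> nat \<Rightarrow> mpoly" where
  "u a = Var (fst a)"

definition f_yv :: "nat \<times> nat \<Rightarrow> nat \<times> nat \<Rightarrow> mpoly" where
  "f_yv y v =
     u (fst y + 1, snd y) * u (fst v + 1, snd v)
   - u (fst y + 2, snd y - 1) * u (fst v, snd v + 1)
   + u (fst y, snd y + 1) * u (fst v, snd v + 1)
   - u (fst y + 1, snd y) * u (fst v - 1, snd v + 2)"

definition gens :: "nat \<Rightarrow> mpoly set" where
  "gens d = {f_yv y v | y v. fst y + snd y = d - 1 \<and> fst v + snd v = d - 1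
                              \<and> snd y \<ge> 1 \<and> fst v \<ge> 1}"

definition mweight :: "monom \<Rightarrow> nat" where
  "mweight m = (\<Sum>i\<in>Poly_Mapping.keys m. i * Poly_Mapping.lookup m i)"

definition lex_less :: "monom \<Rightarrow> monom \<Rightarrow> bool" where
  "lex_less m m' \<longleftrightarrow> (\<exists>j. Poly_Mapping.lookup m j < Poly_Mapping.lookup m' j \<and> (\<forall>k>j. Poly_Mapping.lookup m k = Poly_Mapping.lookup m' k))"

definition term_less :: "monom \<Rightarrow> monom \<Rightarrow> bool" where
  "term_less m m' \<longleftrightarrow> mweight m < mweight m' \<or> (mweight m = mweight m' \<and> lex_less m m')"

definition lead_monom :: "mpoly \<Rightarrow> monom" where
  "lead_monom p = (THE m. m \<in> Poly_Mapping.keys p \<and> (\<forall>m'\<in>Poly_Mapping.keys p. m' \<noteq> m \<longrightarrow> term_less m' m))"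

definition monom_dvd :: "monom \<Rightarrow> monom \<Rightarrow> bool" where
  "monom_dvd m m' \<longleftrightarrow> (\<forall>i. Poly_Mapping.lookup m i \<le> Poly_Mapping.lookup m' i)"

definition groebner_basis :: "mpoly set \<Rightarrow> mpoly set \<Rightarrow> bool" where
  "groebner_basis G J \<longleftrightarrow> G \<subseteq> J \<and>
     (\<forall>f\<in>J. f \<noteq> 0 \<longrightarrow> (\<exists>g\<in>G. g \<noteq> 0 \<and> monom_dvd (lead_monom g) (lead_monom f)))"

(* Affine space S^d(C^2) = C^{d+1}, as points x with x i = 0 for i > d. *)
definition aspace :: "nat \<Rightarrow> (nat \<Rightarrow> complex) set" where
  "aspace d = {x. \<forall>i>d. x i = 0}"

definition zero_set :: "nat \<Rightarrow> mpoly set \<Rightarrow> (nat \<Rightarrow> complex) set" where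
  "zero_set d S = {x\<in>aspace d. \<forall>f\<in>S. eval_mpoly f x = 0}"

definition vanishing_ideal :: "nat \<Rightarrow> (nat \<Rightarrow> complex) set \<Rightarrow> mpoly set" where
  "vanishing_ideal d Z = {f\<in>polyring d. \<forall>x\<in>Z. eval_mpoly f x = 0}"

definition zariski_closed :: "nat \<Rightarrow> (nat \<Rightarrow> complex) set \<Rightarrow> bool" where
  "zariski_closed d C \<longleftrightarrow> (\<exists>S\<subseteq>polyring d. C = zero_set d S)"

definition zariski_closure :: "nat \<Rightarrow> (nat \<Rightarrow> complex) set \<Rightarrow> (nat \<Rightarrow> complex) set" where
  "zariski_closure d Z = \<Inter>{C. zariski_closed d C \<and> Z \<subseteq> C}"

definition irreducible_closed :: "nat \<Rightarrow> (nat \<Rightarrow> complex) set \<Rightarrow> bool" where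
  "irreducible_closed d Z \<longleftrightarrow> zariski_closed d Z \<and> Z \<noteq> {} \<and>
     (\<forall>A B. zariski_closed d A \<and> zariski_closed d B \<and> Z = A \<union> B \<longrightarrow> Z = A \<or> Z = B)"

definition irr_chain :: "nat \<Rightarrow> (nat \<Rightarrow> complex) set \<Rightarrow> nat \<Rightarrow> bool" where
  "irr_chain d V n \<longleftrightarrow> (\<exists>Z :: nat \<Rightarrow> (nat \<Rightarrow> complex) set.
     (\<forall>k\<le>n. irreducible_closed d (Z k) \<and> Z k \<subseteq> V) \<and> (\<forall>k<n. Z k \<subset> Z (Suc k)))"

definition has_dim :: "nat \<Rightarrow> (nat \<Rightarrow> complex) set \<Rightarrow> nat \<Rightarrow> bool" where
  "has_dim d V n \<longleftrightarrow> irr_chain d V n \<and> \<not> irr_chain d V (Suc n)"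

(* Real odeco tensors T = l1 v1^d + l2 v2^d (v1, v2 orthonormal in R^2), in coordinates
  u_{i(d-i)} = d! T_{1..1 2..2} = d! (l1 p1^i q1^(d-i) + l2 p2^i q2^(d-i)), v_k = (p_k, q_k). *)
definition odeco_tensors :: "nat \<Rightarrow> (nat \<Rightarrow> complex) set" where
  "odeco_tensors d = {x. \<exists>(l1::real) l2 p1 q1 p2 q2.
      p1\<^sup>2 + q1\<^sup>2 = 1 \<and> p2\<^sup>2 + q2\<^sup>2 = 1 \<and> p1 * p2 + q1 * q2 = 0 \<and>
      x = (\<lambda>i. if i \<le> d then complex_of_real (fact d *
              (l1 * p1 ^ i * q1 ^ (d - i) + l2 * p2 ^ i * q2 ^ (d - i))) else 0)}"

definition odeco_variety :: "nat \<Rightarrow> (nat \<Rightarrow> complex) set" where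
  "odeco_variety d = zariski_closure d (odeco_tensors d)"

end

theory Submission
  imports Defs "HOL-Computational_Algebra.Polynomial" "HOL-Library.Function_Algebras"
begin

text \<open>The generators are the \<open>2 \<times> 2\<close> minors of the matrix with columns
  \<open>(u\<^sub>k, u\<^bsub>k+1\<^esub> - u\<^bsub>k-1\<^esub>)\<close>, \<open>1 \<le> k < d\<close>. Their leading monomials are the
  \<open>u\<^sub>i u\<^sub>j\<close> with \<open>1 \<le> i\<close> and \<open>i + 2 \<le> j \<le> d\<close>, so modulo \<open>I\<close> every polynomial is a combination
  of the monomials \<open>u\<^sub>0\<^sup>k u\<^sub>i\<^sup>p u\<^bsub>i+1\<^esub>\<^sup>q\<close>. The odeco tensors are the points
  \<open>u\<^sub>i = a t\<^sup>i + b (-1)\<^sup>i t\<^bsup>d-i\<^esup>\<close> with \<open>a, b, t\<close> real, and along suitable curves in this parameter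
  space those monomials acquire pairwise distinct degrees, so no nontrivial combination of them vanishes
  on the odeco tensors. Hence \<open>I\<close> is the full vanishing ideal and the generators are a Groebner basis.
  Primality follows by restricting to lines in the parameter space. For the dimension, a chain
  of irreducible closed sets of length \<open>k\<close> yields \<open>k\<close> functions that are algebraically independent
  modulo \<open>I\<close>, and counting monomials shows that four polynomials in \<open>a, b, t\<close> are algebraically
  dependent.\<close>

section \<open>Monomials and evaluation\<close>

text \<open>The weights are a parameter because several occur: the index for the term order, its
  square for termination, counts of variables, and degrees along a curve.\<close>

definition wdeg :: "(nat \<Rightarrow> nat) \<Rightarrow> monom \<Rightarrow> nat" where
  "wdeg w m = (\<Sum>i\<in>Poly_Mapping.keys m. w i * Poly_Mapping.lookup m i)"

lemma wdeg_superset: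
  assumes "finite A" "Poly_Mapping.keys m \<subseteq> A"
  shows "wdeg w m = (\<Sum>i\<in>A. w i * Poly_Mapping.lookup m i)"
  unfolding wdeg_def using assms
  by (intro sum.mono_neutral_left) (auto simp: in_keys_iff)

lemma wdeg_add: "wdeg w (m + n) = wdeg w m + wdeg w n"
proof -
  let ?A = "Poly_Mapping.keys m \<union> Poly_Mapping.keys n"
  have "finite ?A" "Poly_Mapping.keys (m + n) \<subseteq> ?A"
    using keys_add[of m n] by auto
  then show ?thesis
    by (simp add: wdeg_superset[of ?A] lookup_add sum.distrib algebra_simps)
qed

lemma wdeg_single [simp]: "wdeg w (Poly_Mapping.single i k) = w i * k"
  by (cases "k = 0") (auto simp: wdeg_def)

lemma wdeg_linear:
  "wdeg (\<lambda>i. a * w i + b * w' i + w'' i) m = a * wdeg w m + b * wdeg w' m + wdeg w'' m"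
  by (simp add: wdeg_def sum.distrib sum_distrib_left algebra_simps)

lemma mweight_eq_wdeg: "mweight = wdeg (\<lambda>i. i)"
  by (simp add: fun_eq_iff mweight_def wdeg_def)

lemma eval_monom_superset:
  assumes "finite A" "Poly_Mapping.keys m \<subseteq> A"
  shows "eval_monom m x = (\<Prod>i\<in>A. x i ^ Poly_Mapping.lookup m i)"
  unfolding eval_monom_def using assms
  by (intro prod.mono_neutral_left) (auto simp: in_keys_iff)

lemma eval_monom_add: "eval_monom (m + n) x = eval_monom m x * eval_monom n x"
proof -
  let ?A = "Poly_Mapping.keys m \<union> Poly_Mapping.keys n"
  have "finite ?A" "Poly_Mapping.keys (m + n) \<subseteq> ?A"
    using keys_add[of m n] by auto
  then show ?thesis
    by (simp add: eval_monom_superset[of ?A] lookup_add prod.distrib power_add)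
qed

lemma eval_monom_zero [simp]: "eval_monom 0 x = 1"
  by (simp add: eval_monom_def)

lemma eval_monom_single [simp]: "eval_monom (Poly_Mapping.single i k) x = x i ^ k"
  by (cases "k = 0") (auto simp: eval_monom_def)

lemma eval_mpoly_superset:
  assumes "finite A" "Poly_Mapping.keys p \<subseteq> A"
  shows "eval_mpoly p x = (\<Sum>m\<in>A. Poly_Mapping.lookup p m * eval_monom m x)"
  unfolding eval_mpoly_def using assms
  by (intro sum.mono_neutral_left) (auto simp: in_keys_iff)

lemma eval_mpoly_add [simp]: "eval_mpoly (p + q) x = eval_mpoly p x + eval_mpoly q x"
proof -
  let ?A = "Poly_Mapping.keys p \<union> Poly_Mapping.keys q"
  have "finite ?A" "Poly_Mapping.keys (p + q) \<subseteq> ?A"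
    using keys_add[of p q] by auto
  then show ?thesis
    by (simp add: eval_mpoly_superset[of ?A] lookup_add sum.distrib algebra_simps)
qed

lemma eval_mpoly_zero [simp]: "eval_mpoly 0 x = 0"
  by (simp add: eval_mpoly_def)

lemma eval_mpoly_uminus [simp]: "eval_mpoly (- p) x = - eval_mpoly p x"
  by (metis add.right_inverse eval_mpoly_add eval_mpoly_zero add_eq_0_iff)

lemma eval_mpoly_diff [simp]: "eval_mpoly (p - q) x = eval_mpoly p x - eval_mpoly q x"
  by (metis eval_mpoly_add eval_mpoly_uminus diff_conv_add_uminus)

lemma eval_mpoly_sum [simp]: "eval_mpoly (\<Sum>i\<in>A. p i) x = (\<Sum>i\<in>A. eval_mpoly (p i) x)"
  by (induction A rule: infinite_finite_induct) auto

lemma eval_mpoly_single [simp]: "eval_mpoly (Poly_Mapping.single m c) x = c * eval_monom m x"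
  by (cases "c = 0") (auto simp: eval_mpoly_def)

lemma eval_mpoly_one [simp]: "eval_mpoly 1 x = 1"
  by (simp flip: single_one)

lemma eval_mpoly_Var [simp]: "eval_mpoly (Var i) x = x i"
  by (simp add: Var_def)

lemma mpoly_eq_sum_single:
  fixes p :: mpoly
  shows "p = (\<Sum>m\<in>Poly_Mapping.keys p. Poly_Mapping.single m (Poly_Mapping.lookup p m))"
  by (rule poly_mapping_eqI)
    (auto simp: lookup_sum lookup_single when_def in_keys_iff sum.delta)

lemma lookup_const_mult:
  fixes p :: mpoly
  shows "Poly_Mapping.lookup (Poly_Mapping.single 0 c * p) m = c * Poly_Mapping.lookup p m"
  by (subst mult_map_scale_conv_mult[symmetric]) (simp add: map.rep_eq when_def)

lemma eval_mpoly_mult [simp]: "eval_mpoly (p * q) x = eval_mpoly p x * eval_mpoly q x"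
proof -
  have "p * q = (\<Sum>m\<in>Poly_Mapping.keys p. \<Sum>n\<in>Poly_Mapping.keys q.
      Poly_Mapping.single (m + n) (Poly_Mapping.lookup p m * Poly_Mapping.lookup q n))"
    by (subst mpoly_eq_sum_single[of p], subst mpoly_eq_sum_single[of q])
      (simp add: sum_product mult_single)
  then show ?thesis
    by (simp add: eval_monom_add eval_mpoly_def[of p] eval_mpoly_def[of q] sum_product mult_ac)
qed

text \<open>Restriction to a polynomial curve turns vanishing questions into questions about
  polynomials in one variable.\<close>

lemma eval_mpoly_on_curve:
  "\<exists>P :: complex poly. \<forall>s. poly P s = eval_mpoly p (\<lambda>i. poly (X i) s)"
  by (rule exI[of _ "\<Sum>m\<in>Poly_Mapping.keys p. smult (Poly_Mapping.lookup p m)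
        (\<Prod>i\<in>Poly_Mapping.keys m. X i ^ Poly_Mapping.lookup m i)"])
    (simp add: eval_mpoly_def eval_monom_def poly_sum poly_prod)

text \<open>A nonzero polynomial has finitely many roots. Testing at real arguments matters because
  the odeco tensors have real parameters.\<close>

lemma poly_eq_0_if_zero_on_reals:
  fixes P :: "complex poly"
  assumes "\<And>r :: real. poly P (of_real r) = 0"
  shows "P = 0"
proof (rule ccontr)
  assume "P \<noteq> 0"
  then have "finite {z. poly P z = 0}" by (rule poly_roots_finite)
  moreover have "range complex_of_real \<subseteq> {z. poly P z = 0}" using assms by auto
  ultimately have "finite (range complex_of_real)" by (rule finite_subset[rotated])
  then show False
    using infinite_UNIV_char_0[where 'a = real] inj_of_real finite_imageD by blast
qed

section \<open>The polynomial ring and its ideals\<close>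

lemma polyring_add: "p \<in> polyring d \<Longrightarrow> q \<in> polyring d \<Longrightarrow> p + q \<in> polyring d"
  using keys_add[of p q] by (force simp: polyring_def)

lemma polyring_mult:
  assumes "p \<in> polyring d" "q \<in> polyring d"
  shows "p * q \<in> polyring d"
proof -
  have "i \<le> d" if mi: "m \<in> Poly_Mapping.keys (p * q)" "i \<in> Poly_Mapping.keys m" for m i
  proof -
    obtain a b where ab: "m = a + b" "a \<in> Poly_Mapping.keys p" "b \<in> Poly_Mapping.keys q"
      using keys_mult[of p q] mi(1) by blast
    then have "i \<in> Poly_Mapping.keys a \<or> i \<in> Poly_Mapping.keys b"
      using keys_add[of a b] mi(2) by blast
    then show ?thesis using assms ab by (auto simp: polyring_def)
  qed
  then show ?thesis by (auto simp: polyring_def)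
qed

lemma polyring_single: "Poly_Mapping.keys m \<subseteq> {..d} \<Longrightarrow> Poly_Mapping.single m c \<in> polyring d"
  by (auto simp: polyring_def split: if_splits)

lemma polyring_const: "Poly_Mapping.single 0 c \<in> polyring d"
  by (rule polyring_single) simp

lemma polyring_zero: "0 \<in> polyring d"
  by (simp add: polyring_def)

lemma polyring_one: "1 \<in> polyring d"
  using polyring_const[of 1] by simp

lemma polyring_uminus: "p \<in> polyring d \<Longrightarrow> - p \<in> polyring d"
  by (simp add: polyring_def)

lemma polyring_diff: "p \<in> polyring d \<Longrightarrow> q \<in> polyring d \<Longrightarrow> p - q \<in> polyring d"
  by (metis diff_conv_add_uminus polyring_add polyring_uminus)

lemma polyring_Var: "i \<le> d \<Longrightarrow> Var i \<in> polyring d"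
  unfolding Var_def by (rule polyring_single) simp

lemma polyring_sum: "(\<And>i. i \<in> A \<Longrightarrow> p i \<in> polyring d) \<Longrightarrow> sum p A \<in> polyring d"
  by (induction A rule: infinite_finite_induct) (auto simp: polyring_zero polyring_add)

lemma is_ideal_polyring: "is_ideal_in (polyring d) (polyring d)"
  by (simp add: is_ideal_in_def polyring_zero polyring_add polyring_mult)

text \<open>The hypothesis makes \<open>polyring d\<close> one of the intersected ideals, so the
  intersection stays inside the ring.\<close>

lemma is_ideal_ideal_gen:
  assumes "S \<subseteq> polyring d"
  shows "is_ideal_in (polyring d) (ideal_gen d S)"
proof -
  have "ideal_gen d S \<subseteq> polyring d"
    unfolding ideal_gen_def using assms is_ideal_polyring by blast
  then show ?thesis
    unfolding is_ideal_in_def ideal_gen_def by blast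
qed

lemma ideal_gen_base: "S \<subseteq> ideal_gen d S"
  by (auto simp: ideal_gen_def)

lemma ideal_gen_least: "is_ideal_in (polyring d) J \<Longrightarrow> S \<subseteq> J \<Longrightarrow> ideal_gen d S \<subseteq> J"
  by (auto simp: ideal_gen_def)

lemma ideal_diff:
  assumes "is_ideal_in (polyring d) J" "a \<in> J" "b \<in> J"
  shows "a - b \<in> J"
proof -
  have "(- 1) * b \<in> J"
    using assms polyring_uminus[OF polyring_one] unfolding is_ideal_in_def by blast
  then show ?thesis
    using assms unfolding is_ideal_in_def by (metis diff_conv_add_uminus mult_minus1)
qed

lemma ideal_sum:
  assumes "is_ideal_in (polyring d) J" "\<And>i. i \<in> A \<Longrightarrow> p i \<in> J"
  shows "sum p A \<in> J"
  using assms(2) by (induction A rule: infinite_finite_induct)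
    (use assms(1) in \<open>auto simp: is_ideal_in_def\<close>)

lemma is_ideal_vanishing_ideal: "is_ideal_in (polyring d) (vanishing_ideal d Z)"
  by (auto simp: is_ideal_in_def vanishing_ideal_def polyring_zero polyring_add polyring_mult)

text \<open>The polynomials vanishing on the zeros of \<open>S\<close> form an ideal containing
  \<open>S\<close>, hence containing the generated ideal.\<close>

lemma zero_set_ideal_gen:
  assumes "S \<subseteq> polyring d"
  shows "zero_set d (ideal_gen d S) = zero_set d S"
proof
  show "zero_set d (ideal_gen d S) \<subseteq> zero_set d S"
    using ideal_gen_base by (auto simp: zero_set_def)
  have "ideal_gen d S \<subseteq> vanishing_ideal d (zero_set d S)"
    by (rule ideal_gen_least[OF is_ideal_vanishing_ideal])
      (use assms in \<open>auto simp: vanishing_ideal_def zero_set_def\<close>)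
  then show "zero_set d S \<subseteq> zero_set d (ideal_gen d S)"
    by (auto simp: vanishing_ideal_def zero_set_def)
qed

lemma zariski_closed_zero_set: "S \<subseteq> polyring d \<Longrightarrow> zariski_closed d (zero_set d S)"
  by (auto simp: zariski_closed_def)

text \<open>Every closed set containing \<open>Z\<close> is cut out by polynomials from the
  vanishing ideal of \<open>Z\<close>, so the zero set of that ideal is the smallest such
  set.\<close>

lemma zariski_closure_eq:
  assumes "Z \<subseteq> aspace d"
  shows "zariski_closure d Z = zero_set d (vanishing_ideal d Z)"
proof
  have "zariski_closed d (zero_set d (vanishing_ideal d Z))"
    by (rule zariski_closed_zero_set) (auto simp: vanishing_ideal_def)
  moreover have "Z \<subseteq> zero_set d (vanishing_ideal d Z)"
    using assms by (auto simp: vanishing_ideal_def zero_set_def)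
  ultimately show "zariski_closure d Z \<subseteq> zero_set d (vanishing_ideal d Z)"
    by (auto simp: zariski_closure_def)
  show "zero_set d (vanishing_ideal d Z) \<subseteq> zariski_closure d Z"
    by (fastforce simp: zariski_closure_def zariski_closed_def zero_set_def vanishing_ideal_def)
qed

text \<open>This allows the odeco variety to be replaced by the real odeco tensors in all statements
  about its ideal.\<close>

lemma vanishing_ideal_zariski_closure:
  assumes "Z \<subseteq> aspace d"
  shows "vanishing_ideal d (zariski_closure d Z) = vanishing_ideal d Z"
  unfolding zariski_closure_eq[OF assms]
  using assms by (auto simp: vanishing_ideal_def zero_set_def)

section \<open>The term order\<close>

lemma lex_less_irrefl: "\<not> lex_less m m"
  by (simp add: lex_less_def)

lemma lex_less_trans:
  assumes "lex_less a b" "lex_less b c"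
  shows "lex_less a c"
proof -
  obtain i where i: "Poly_Mapping.lookup a i < Poly_Mapping.lookup b i"
    "\<forall>k>i. Poly_Mapping.lookup a k = Poly_Mapping.lookup b k"
    using assms(1) by (auto simp: lex_less_def)
  obtain j where j: "Poly_Mapping.lookup b j < Poly_Mapping.lookup c j"
    "\<forall>k>j. Poly_Mapping.lookup b k = Poly_Mapping.lookup c k"
    using assms(2) by (auto simp: lex_less_def)
  have "Poly_Mapping.lookup a (max i j) < Poly_Mapping.lookup c (max i j)"
    using i j by (cases i j rule: linorder_cases) (auto simp: max_def)
  moreover have "\<forall>k>max i j. Poly_Mapping.lookup a k = Poly_Mapping.lookup c k"
    using i j by auto
  ultimately show ?thesis by (auto simp: lex_less_def)
qed

text \<open>Two exponent vectors differ at finitely many indices, and the largest of these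
  decides.\<close>

lemma lex_less_total:
  assumes "a \<noteq> b"
  shows "lex_less a b \<or> lex_less b a"
proof -
  let ?D = "{k. Poly_Mapping.lookup a k \<noteq> Poly_Mapping.lookup b k}"
  have "?D \<subseteq> Poly_Mapping.keys a \<union> Poly_Mapping.keys b"
    by (auto simp: in_keys_iff)
  then have fin: "finite ?D" by (rule finite_subset) simp
  have ne: "?D \<noteq> {}" using assms by (auto intro: poly_mapping_eqI)
  define M where "M = Max ?D"
  have neq: "Poly_Mapping.lookup a M \<noteq> Poly_Mapping.lookup b M"
    using Max_in[OF fin ne] by (simp add: M_def)
  have eq: "Poly_Mapping.lookup a k = Poly_Mapping.lookup b k" if "k > M" for k
    using Max_ge[OF fin, of k] that unfolding M_def by (meson leD mem_Collect_eq)
  show ?thesis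
  proof (cases "Poly_Mapping.lookup a M < Poly_Mapping.lookup b M")
    case True
    then have "lex_less a b" using eq unfolding lex_less_def by blast
    then show ?thesis ..
  next
    case False
    then have "Poly_Mapping.lookup b M < Poly_Mapping.lookup a M" using neq by linarith
    then have "lex_less b a" using eq[symmetric] unfolding lex_less_def by blast
    then show ?thesis ..
  qed
qed

lemma lex_less_add: "lex_less a b \<Longrightarrow> lex_less (c + a) (c + b)"
  by (auto simp: lex_less_def lookup_add)

lemma term_less_irrefl: "\<not> term_less m m"
  by (simp add: term_less_def lex_less_irrefl)

lemma term_less_trans: "term_less a b \<Longrightarrow> term_less b c \<Longrightarrow> term_less a c"
  by (auto simp: term_less_def intro: lex_less_trans)

lemma term_less_total: "a \<noteq> b \<Longrightarrow> term_less a b \<or> term_less b a"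
  using lex_less_total by (auto simp: term_less_def)

lemma term_less_add: "term_less a b \<Longrightarrow> term_less (c + a) (c + b)"
  by (auto simp: term_less_def mweight_eq_wdeg wdeg_add lex_less_add)

lemma lead_monom_eqI:
  assumes "m \<in> Poly_Mapping.keys p"
    and "\<And>n. n \<in> Poly_Mapping.keys p \<Longrightarrow> n \<noteq> m \<Longrightarrow> term_less n m"
  shows "lead_monom p = m"
  unfolding lead_monom_def
proof (rule the_equality)
  show "m \<in> Poly_Mapping.keys p \<and> (\<forall>m'\<in>Poly_Mapping.keys p. m' \<noteq> m \<longrightarrow> term_less m' m)"
    using assms by blast
next
  fix n assume "n \<in> Poly_Mapping.keys p \<and> (\<forall>m'\<in>Poly_Mapping.keys p. m' \<noteq> n \<longrightarrow> term_less m' n)"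
  then show "n = m"
    using assms term_less_trans[of n m n] term_less_irrefl[of n] by metis
qed

lemma finite_term_less_max:
  assumes "finite A" "A \<noteq> {}"
  shows "\<exists>m\<in>A. \<forall>n\<in>A. n \<noteq> m \<longrightarrow> term_less n m"
  using assms
proof (induction rule: finite_ne_induct)
  case (insert x F)
  then obtain m where m: "m \<in> F" "\<forall>n\<in>F. n \<noteq> m \<longrightarrow> term_less n m" by blast
  show ?case
  proof (cases "term_less x m")
    case True
    then show ?thesis using m by blast
  next
    case False
    then have "term_less m x"
      using m insert.hyps term_less_total by metis
    then have "\<forall>n\<in>F. term_less n x" using m term_less_trans by metis
    then show ?thesis by blast
  qed
qed simp

lemma lead_monom_is_max:
  assumes "p \<noteq> 0"
  shows "lead_monom p \<in> Poly_Mapping.keys p"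
    and "\<And>n. n \<in> Poly_Mapping.keys p \<Longrightarrow> n \<noteq> lead_monom p \<Longrightarrow> term_less n (lead_monom p)"
proof -
  obtain m where m: "m \<in> Poly_Mapping.keys p"
    "\<forall>n\<in>Poly_Mapping.keys p. n \<noteq> m \<longrightarrow> term_less n m"
    using finite_term_less_max[of "Poly_Mapping.keys p"] assms by auto
  then have "lead_monom p = m" by (intro lead_monom_eqI) auto
  with m show "lead_monom p \<in> Poly_Mapping.keys p"
    and "\<And>n. n \<in> Poly_Mapping.keys p \<Longrightarrow> n \<noteq> lead_monom p \<Longrightarrow> term_less n (lead_monom p)"
    by auto
qed

section \<open>The generators and reduction to standard monomials\<close>

text \<open>The minor of columns \<open>i\<close> and \<open>j - 1\<close>, that is,
  \<open>u_i (u_j - u_(j-2)) - u_(j-1) (u_(i+1) - u_(i-1))\<close>. It is \<open>f_yv y v\<close>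
  with \<open>i = fst y + 1\<close> and \<open>j = fst v + 1\<close>.\<close>

definition gen :: "nat \<Rightarrow> nat \<Rightarrow> mpoly" where
  "gen i j = Var i * Var j - Var (i + 1) * Var (j - 1)
    + Var (i - 1) * Var (j - 1) - Var i * Var (j - 2)"

text \<open>After the change of indices the condition \<open>snd y >= 1\<close> reads
  \<open>i < d\<close>, and \<open>fst v >= 1\<close> reads \<open>2 <= j\<close>.\<close>

lemma gens_eq: "gens d = {gen i j | i j. 1 \<le> i \<and> i < d \<and> 2 \<le> j \<and> j \<le> d}"
proof (intro equalityI subsetI)
  fix g assume "g \<in> gens d"
  then obtain y v where yv: "g = f_yv y v" "fst y + snd y = d - 1" "fst v + snd v = d - 1"
    "snd y \<ge> 1" "fst v \<ge> 1"
    by (auto simp: gens_def)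
  then have "g = gen (fst y + 1) (fst v + 1)"
    by (simp add: gen_def f_yv_def u_def numeral_2_eq_2)
  moreover have "1 \<le> fst y + 1" "fst y + 1 < d" "2 \<le> fst v + 1" "fst v + 1 \<le> d"
    using yv by auto
  ultimately show "g \<in> {gen i j | i j. 1 \<le> i \<and> i < d \<and> 2 \<le> j \<and> j \<le> d}" by blast
next
  fix g assume "g \<in> {gen i j | i j. 1 \<le> i \<and> i < d \<and> 2 \<le> j \<and> j \<le> d}"
  then obtain i j where ij: "g = gen i j" "1 \<le> i" "i < d" "2 \<le> j" "j \<le> d" by blast
  then have "i + 1 = (i - 1) + 2" "(i - 1) + 1 = i" "(j - 1) + 1 = j" "j - 1 - 1 = j - 2"
    by auto
  then have "g = f_yv (i - 1, d - i) (j - 1, d - j)"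
    unfolding ij(1) gen_def f_yv_def u_def fst_conv snd_conv by metis
  moreover have "i - 1 + (d - i) = d - 1" "j - 1 + (d - j) = d - 1" "d - i \<ge> 1" "j - 1 \<ge> 1"
    using ij by auto
  ultimately show "g \<in> gens d"
    unfolding gens_def by (intro CollectI exI[of _ "(i - 1, d - i)"] exI[of _ "(j - 1, d - j)"]) simp
qed

lemma gens_subset_polyring: "gens d \<subseteq> polyring d"
  unfolding gens_eq gen_def
  by (auto intro!: polyring_diff polyring_add polyring_mult polyring_Var)

section \<open>Leading monomials of the generators\<close>

definition quad :: "nat \<Rightarrow> nat \<Rightarrow> monom" where
  "quad i j = Poly_Mapping.single i 1 + Poly_Mapping.single j 1"

lemma Var_mult_Var: "Var i * Var j = Poly_Mapping.single (quad i j) 1"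
  by (simp add: Var_def quad_def mult_single)

lemma lookup_quad:
  "Poly_Mapping.lookup (quad i j) k = (if k = i then 1 else 0) + (if k = j then 1 else 0)"
  by (simp add: quad_def lookup_add lookup_single when_def)

lemma wdeg_quad: "wdeg w (quad i j) = w i + w j"
  by (simp add: quad_def wdeg_add)

lemma keys_quad: "Poly_Mapping.keys (quad i j) = {i, j}"
  by (auto simp: in_keys_iff lookup_quad split: if_splits)

text \<open>The last two monomials have weight smaller by 2. The first one ties in weight, and the
  lexicographic order decides: its indices \<open>i + 1\<close> and \<open>j - 1\<close> are both
  below \<open>j\<close>.\<close>

lemma gen_tail_less:
  assumes "1 \<le> i" "i + 2 \<le> j"
  shows "term_less (quad (i + 1) (j - 1)) (quad i j)"
    and "term_less (quad (i - 1) (j - 1)) (quad i j)"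
    and "term_less (quad i (j - 2)) (quad i j)"
proof -
  have "lex_less (quad (i + 1) (j - 1)) (quad i j)"
    unfolding lex_less_def using assms by (intro exI[of _ j]) (auto simp: lookup_quad)
  moreover have "mweight (quad (i + 1) (j - 1)) = mweight (quad i j)"
    using assms by (simp add: mweight_eq_wdeg wdeg_quad)
  ultimately show "term_less (quad (i + 1) (j - 1)) (quad i j)"
    by (simp add: term_less_def)
  show "term_less (quad (i - 1) (j - 1)) (quad i j)" "term_less (quad i (j - 2)) (quad i j)"
    using assms by (simp_all add: term_less_def mweight_eq_wdeg wdeg_quad)
qed

lemma gen_eq_singles:
  "gen i j = Poly_Mapping.single (quad i j) 1 - Poly_Mapping.single (quad (i + 1) (j - 1)) 1
    + Poly_Mapping.single (quad (i - 1) (j - 1)) 1 - Poly_Mapping.single (quad i (j - 2)) 1"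
  by (simp add: gen_def Var_mult_Var)

text \<open>The tail monomials are strictly smaller, hence different from \<open>quad i j\<close>,
  so its coefficient is not cancelled.\<close>

lemma lead_monom_gen:
  assumes "1 \<le> i" "i + 2 \<le> j"
  shows "gen i j \<noteq> 0" "lead_monom (gen i j) = quad i j"
proof -
  have ne: "quad (i + 1) (j - 1) \<noteq> quad i j" "quad (i - 1) (j - 1) \<noteq> quad i j"
    "quad i (j - 2) \<noteq> quad i j"
    using gen_tail_less[OF assms] term_less_irrefl by metis+
  have in_keys: "quad i j \<in> Poly_Mapping.keys (gen i j)"
    using ne by (simp add: in_keys_iff gen_eq_singles lookup_minus lookup_add lookup_single when_def)
  then show "gen i j \<noteq> 0" by auto
  have "n \<in> {quad i j, quad (i + 1) (j - 1), quad (i - 1) (j - 1), quad i (j - 2)}"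
    if "n \<in> Poly_Mapping.keys (gen i j)" for n
    using that by (auto simp: in_keys_iff gen_eq_singles lookup_minus lookup_add lookup_single when_def
        split: if_splits)
  then show "lead_monom (gen i j) = quad i j"
    using gen_tail_less[OF assms] by (intro lead_monom_eqI in_keys) auto
qed

text \<open>The monomials \<open>u\<^sub>0\<^sup>k u\<^sub>i\<^sup>p u\<^bsub>i+1\<^esub>\<^sup>q\<close> with \<open>i \<ge> 1\<close>.\<close>

definition standard_monom :: "nat \<Rightarrow> monom \<Rightarrow> bool" where
  "standard_monom d m \<longleftrightarrow> Poly_Mapping.keys m \<subseteq> {..d} \<and>
     (\<forall>i\<in>Poly_Mapping.keys m. \<forall>j\<in>Poly_Mapping.keys m. 1 \<le> i \<longrightarrow> j < i + 2)"

text \<open>For distinct indices each variable is needed only to the first power, so occurrence in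
  \<open>m\<close> suffices.\<close>

lemma quad_dvdD:
  assumes "i \<in> Poly_Mapping.keys m" "j \<in> Poly_Mapping.keys m" "i \<noteq> j"
  shows "monom_dvd (quad i j) m" "\<exists>m'. m = m' + quad i j"
proof -
  show dvd: "monom_dvd (quad i j) m"
    using assms by (auto simp: monom_dvd_def lookup_quad in_keys_iff)
  have "m = (m - quad i j) + quad i j"
    by (rule poly_mapping_eqI) (use dvd in \<open>simp add: monom_dvd_def lookup_add lookup_minus\<close>)
  then show "\<exists>m'. m = m' + quad i j" ..
qed

text \<open>Each rewriting step lowers the weight \<open>\<Sum>i\<^sup>2 m\<^sub>i\<close>, because squaring is strictly convex and increasing.\<close>

lemma monom_reduces_to_standard:
  assumes "Poly_Mapping.keys m \<subseteq> {..d}"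
  shows "\<exists>N. (\<forall>n\<in>Poly_Mapping.keys N. standard_monom d n \<and> (n = m \<or> term_less n m)) \<and>
    Poly_Mapping.single m 1 - N \<in> ideal_gen d (gens d) \<and>
    (standard_monom d m \<longrightarrow> N = Poly_Mapping.single m 1)"
  using assms
proof (induction "wdeg (\<lambda>i. i\<^sup>2) m" arbitrary: m rule: less_induct)
  case less
  let ?I = "ideal_gen d (gens d)"
  let ?X = "\<lambda>m. Poly_Mapping.single m 1 :: mpoly"
  note I = is_ideal_ideal_gen[OF gens_subset_polyring, of d]
  show ?case
  proof (cases "standard_monom d m")
    case True
    have "?X m - ?X m \<in> ?I" using I by (simp add: is_ideal_in_def)
    then show ?thesis using True by (intro exI[of _ "?X m"]) auto
  next
    case False
    then obtain i j where ij: "i \<in> Poly_Mapping.keys m" "j \<in> Poly_Mapping.keys m" "1 \<le> i" "i + 2 \<le> j"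
      using less.prems by (auto simp: standard_monom_def not_less)
    then have jd: "j \<le> d" using less.prems by auto
    obtain m' where m': "m = m' + quad i j"
      using quad_dvdD(2)[OF ij(1,2)] ij by auto
    have keys_m': "Poly_Mapping.keys m' \<subseteq> {..d}"
      using less.prems by (auto simp: m' in_keys_iff lookup_add subset_iff)
    \<comment> \<open>Any replacement of \<open>quad i j\<close> by a term smaller in both orders
      falls under the induction hypothesis; it is applied to the three tail monomials of
      \<open>gen i j\<close>.\<close>
    have step: "\<exists>N. (\<forall>n\<in>Poly_Mapping.keys N. standard_monom d n \<and> term_less n m) \<and>
        ?X (m' + quad k l) - N \<in> ?I"
      if "k \<le> d" "l \<le> d" "k\<^sup>2 + l\<^sup>2 < i\<^sup>2 + j\<^sup>2" "term_less (quad k l) (quad i j)" for k l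
    proof -
      have "Poly_Mapping.keys (m' + quad k l) \<subseteq> {..d}"
        using keys_add[of m' "quad k l"] keys_m' that by (auto simp: keys_quad)
      moreover have "wdeg (\<lambda>i. i\<^sup>2) (m' + quad k l) < wdeg (\<lambda>i. i\<^sup>2) m"
        using that by (simp add: m' wdeg_add wdeg_quad)
      ultimately obtain N where N:  "\<forall>n\<in>Poly_Mapping.keys N. standard_monom d n \<and>
          (n = m' + quad k l \<or> term_less n (m' + quad k l))" "?X (m' + quad k l) - N \<in> ?I"
        using less.hyps by blast
      have "term_less (m' + quad k l) m"
        unfolding m' by (rule term_less_add) fact
      then have "\<forall>n\<in>Poly_Mapping.keys N. standard_monom d n \<and> term_less n m"
        using N(1) term_less_trans[of _ "m' + quad k l" m] by metis
      then show ?thesis using N(2) by blast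
    qed
    \<comment> \<open>These substitutions remove truncated subtraction from the three inequalities
      between sums of squares.\<close>
    obtain a b where ab: "i = Suc a" "j = Suc (Suc b)" "a < b"
      using ij by (intro that[of "i - 1" "j - 2"]) auto
    note less = gen_tail_less[OF ij(3,4)]
    obtain A where A: "\<forall>n\<in>Poly_Mapping.keys A. standard_monom d n \<and> term_less n m"
        "?X (m' + quad (i + 1) (j - 1)) - A \<in> ?I"
      using step[OF _ _ _ less(1)] ij jd ab by (auto simp: power2_eq_square)
    obtain B where B: "\<forall>n\<in>Poly_Mapping.keys B. standard_monom d n \<and> term_less n m"
        "?X (m' + quad (i - 1) (j - 1)) - B \<in> ?I"
      using step[OF _ _ _ less(2)] ij jd ab by (auto simp: power2_eq_square)
    obtain C where C: "\<forall>n\<in>Poly_Mapping.keys C. standard_monom d n \<and> term_less n m"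
        "?X (m' + quad i (j - 2)) - C \<in> ?I"
      using step[OF _ _ _ less(3)] ij jd ab by (auto simp: power2_eq_square)
    have "gen i j \<in> ?I"
      using ideal_gen_base[of "gens d" d] ij jd unfolding gens_eq by force
    then have "?X m' * gen i j \<in> ?I"
      using I polyring_single[OF keys_m'] by (auto simp: is_ideal_in_def)
    \<comment> \<open>The multiple of the generator trades \<open>m\<close> for its three tail
      monomials, and the other summands trade these for \<open>A\<close>, \<open>B\<close>,
      \<open>C\<close> with the signs of \<open>gen\<close>.\<close>
    then have "?X m' * gen i j + (?X (m' + quad (i + 1) (j - 1)) - A)
        - (?X (m' + quad (i - 1) (j - 1)) - B) + (?X (m' + quad i (j - 2)) - C) \<in> ?I"
      using A(2) B(2) C(2) I ideal_diff[OF I] by (simp add: is_ideal_in_def)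
    also have "?X m' * gen i j + (?X (m' + quad (i + 1) (j - 1)) - A)
        - (?X (m' + quad (i - 1) (j - 1)) - B) + (?X (m' + quad i (j - 2)) - C)
        = ?X m - (A - B + C)"
      by (simp add: gen_eq_singles algebra_simps mult_single m')
    finally have "?X m - (A - B + C) \<in> ?I" .
    moreover have "\<forall>n\<in>Poly_Mapping.keys (A - B + C). standard_monom d n \<and> term_less n m"
      using keys_add[of "A - B" C] keys_diff[of A B] A(1) B(1) C(1) by blast
    ultimately show ?thesis using False by blast
  qed
qed

text \<open>Linear extension of the reduction of monomials. The last conclusion serves the Groebner
  basis property: the other terms of \<open>p\<close> reduce to monomials below the leading one, so
  a standard leading monomial keeps its coefficient.\<close>

lemma reduces_to_standard:
  assumes "p \<in> polyring d"
  obtains N where "\<forall>n\<in>Poly_Mapping.keys N. standard_monom d n" "p - N \<in> ideal_gen d (gens d)"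
    and "p \<noteq> 0 \<Longrightarrow> standard_monom d (lead_monom p) \<Longrightarrow> N \<noteq> 0"
proof -
  let ?I = "ideal_gen d (gens d)"
  let ?K = "Poly_Mapping.keys p"
  let ?c = "\<lambda>m. Poly_Mapping.single 0 (Poly_Mapping.lookup p m) :: mpoly"
  note I = is_ideal_ideal_gen[OF gens_subset_polyring, of d]
  have "\<forall>m\<in>?K. \<exists>N. (\<forall>n\<in>Poly_Mapping.keys N. standard_monom d n \<and> (n = m \<or> term_less n m)) \<and>
      Poly_Mapping.single m 1 - N \<in> ?I \<and> (standard_monom d m \<longrightarrow> N = Poly_Mapping.single m 1)"
    using assms by (intro ballI monom_reduces_to_standard) (auto simp: polyring_def)
  then obtain R where R: "\<And>m. m \<in> ?K \<Longrightarrow>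
      (\<forall>n\<in>Poly_Mapping.keys (R m). standard_monom d n \<and> (n = m \<or> term_less n m)) \<and>
      Poly_Mapping.single m 1 - R m \<in> ?I \<and> (standard_monom d m \<longrightarrow> R m = Poly_Mapping.single m 1)"
    by metis
  define N where "N = (\<Sum>m\<in>?K. ?c m * R m)"
  have lookup_N: "Poly_Mapping.lookup N n = (\<Sum>m\<in>?K. Poly_Mapping.lookup p m * Poly_Mapping.lookup (R m) n)" for n
    by (simp add: N_def lookup_sum lookup_const_mult)
  show thesis
  proof
    show "\<forall>n\<in>Poly_Mapping.keys N. standard_monom d n"
    proof
      fix n assume "n \<in> Poly_Mapping.keys N"
      then have "(\<Sum>m\<in>?K. Poly_Mapping.lookup p m * Poly_Mapping.lookup (R m) n) \<noteq> 0"
        by (simp add: in_keys_iff lookup_N)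
      then obtain m where "m \<in> ?K" "Poly_Mapping.lookup (R m) n \<noteq> 0"
        by (rule sum.not_neutral_contains_not_neutral) auto
      then show "standard_monom d n" using R by (auto simp: in_keys_iff)
    qed
    have "(\<Sum>m\<in>?K. ?c m * (Poly_Mapping.single m 1 - R m)) \<in> ?I"
      by (rule ideal_sum[OF I]) (use I R polyring_const in \<open>simp add: is_ideal_in_def\<close>)
    also have "(\<Sum>m\<in>?K. ?c m * (Poly_Mapping.single m 1 - R m)) = p - N"
      by (subst (3) mpoly_eq_sum_single[of p])
        (simp add: N_def right_diff_distrib mult_single sum_subtractf)
    finally show "p - N \<in> ?I" .
    assume p: "p \<noteq> 0" and st: "standard_monom d (lead_monom p)"
    let ?L = "lead_monom p"
    note L = lead_monom_is_max[OF p]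
    have "Poly_Mapping.lookup (R m) ?L = 0" if "m \<in> ?K" "m \<noteq> ?L" for m
    proof (rule ccontr)
      assume "Poly_Mapping.lookup (R m) ?L \<noteq> 0"
      then have "?L = m \<or> term_less ?L m" using R[OF that(1)] by (simp add: in_keys_iff)
      then show False using L(2)[OF that] that term_less_trans term_less_irrefl by metis
    qed
    then have "Poly_Mapping.lookup N ?L = (\<Sum>m\<in>?K. if m = ?L then Poly_Mapping.lookup p ?L else 0)"
      unfolding lookup_N using R[OF L(1)] st by (intro sum.cong) auto
    also have "\<dots> = Poly_Mapping.lookup p ?L" using L(1) by simp
    finally show "N \<noteq> 0" using L(1) by (auto simp: in_keys_iff)
  qed
qed

section \<open>Parametrization of the odeco tensors\<close>

text \<open>The orthonormal basis is \<open>(t, 1) / r\<close>, \<open>(- 1, t) / r\<close> with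
  \<open>r = sqrt (1 + t^2)\<close>; the factor \<open>d!\<close> and the powers of \<open>r\<close>
  are absorbed into \<open>a\<close> and \<open>b\<close>.\<close>

definition odeco_param :: "nat \<Rightarrow> real \<times> real \<times> real \<Rightarrow> nat \<Rightarrow> complex" where
  "odeco_param d = (\<lambda>(a, b, t) i. if i \<le> d
     then complex_of_real (a * t ^ i + b * (- 1) ^ i * t ^ (d - i)) else 0)"

lemma odeco_tensors_eq: "odeco_tensors d = range (odeco_param d)"
proof (intro equalityI subsetI)
  fix x assume "x \<in> odeco_tensors d"
  then obtain l1 l2 p1 q1 p2 q2 :: real where
    o: "p1\<^sup>2 + q1\<^sup>2 = 1" "p2\<^sup>2 + q2\<^sup>2 = 1" "p1 * p2 + q1 * q2 = 0" and
    x: "x = (\<lambda>i. if i \<le> d then complex_of_real (fact d *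
              (l1 * p1 ^ i * q1 ^ (d - i) + l2 * p2 ^ i * q2 ^ (d - i))) else 0)"
    unfolding odeco_tensors_def by blast
  \<comment> \<open>The determinant of the basis: \<open>(p2, q2)\<close> is \<open>e\<close> times
    the quarter turn \<open>(- q1, p1)\<close> of the first vector.\<close>
  define e where "e = p1 * q2 - q1 * p2"
  have p2: "p2 = - e * q1"
  proof -
    have "- e * q1 = q1\<^sup>2 * p2 - p1 * (q1 * q2)" by (simp add: e_def algebra_simps power2_eq_square)
    also have "q1 * q2 = - (p1 * p2)" using o by linarith
    also have "q1\<^sup>2 * p2 - p1 * - (p1 * p2) = (p1\<^sup>2 + q1\<^sup>2) * p2"
      by (simp add: algebra_simps power2_eq_square)
    finally show ?thesis using o by simp
  qed
  have q2: "q2 = e * p1"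
  proof -
    have "e * p1 = p1\<^sup>2 * q2 - q1 * (p1 * p2)" by (simp add: e_def algebra_simps power2_eq_square)
    also have "p1 * p2 = - (q1 * q2)" using o by linarith
    also have "p1\<^sup>2 * q2 - q1 * - (q1 * q2) = (p1\<^sup>2 + q1\<^sup>2) * q2"
      by (simp add: algebra_simps power2_eq_square)
    finally show ?thesis using o by simp
  qed
  have pq: "p2 ^ i * q2 ^ (d - i) = e ^ d * (- 1) ^ i * q1 ^ i * p1 ^ (d - i)" if "i \<le> d" for i
  proof -
    have "p2 ^ i * q2 ^ (d - i) = (e ^ i * e ^ (d - i)) * (- 1) ^ i * q1 ^ i * p1 ^ (d - i)"
      unfolding p2 q2 by (simp add: power_mult_distrib power_minus[of "e * q1"] mult_ac)
    also have "e ^ i * e ^ (d - i) = e ^ d" using that by (simp flip: power_add)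
    finally show ?thesis .
  qed
  show "x \<in> range (odeco_param d)"
  proof (cases "q1 = 0")
    \<comment> \<open>The basis consists of coordinate vectors up to sign. At \<open>t = 0\<close>
      it appears in the other order, so \<open>l2\<close> goes into \<open>a\<close> and
      \<open>l1\<close> into \<open>b\<close>; the factor \<open>(- 1) ^ d\<close> cancels
      \<open>(- 1) ^ i\<close>, which only counts at \<open>i = d\<close>.\<close>
    case True
    then have "p1\<^sup>2 = 1" using o by simp
    then have p1: "p1 = 1 \<or> p1 = - 1" by (simp add: power2_eq_1_iff)
    have eq: "fact d * (l1 * p1 ^ i * q1 ^ (d - i) + l2 * p2 ^ i * q2 ^ (d - i)) =
        (fact d * l2 * e ^ d * p1 ^ d) * 0 ^ i + (fact d * l1 * p1 ^ d * (- 1) ^ d) * (- 1) ^ i * 0 ^ (d - i)"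
      if "i \<le> d" for i
    proof -
      have "fact d * (l1 * p1 ^ i * q1 ^ (d - i) + l2 * p2 ^ i * q2 ^ (d - i)) =
          fact d * (l1 * p1 ^ i * 0 ^ (d - i) + l2 * (e ^ d * (- 1) ^ i * 0 ^ i * p1 ^ (d - i)))"
        using pq[OF that] True by (simp add: mult.assoc)
      also have "\<dots> = (fact d * l2 * e ^ d * p1 ^ d) * 0 ^ i
          + (fact d * l1 * p1 ^ d * (- 1) ^ d) * (- 1) ^ i * 0 ^ (d - i)"
      proof -
        have "(- 1) ^ d * (- 1) ^ d = (1 :: real)" by (simp flip: power_mult_distrib)
        then have "x * (- 1) ^ d * (- 1) ^ d = x" for x :: real by (simp add: mult.assoc)
        then show ?thesis
          using that by (cases "i = 0"; cases "i = d") (simp_all add: power_0_left distrib_left mult_ac)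
      qed
      finally show ?thesis .
    qed
    have "x = odeco_param d (fact d * l2 * e ^ d * p1 ^ d, fact d * l1 * p1 ^ d * (- 1) ^ d, 0)"
      unfolding x odeco_param_def using eq by (auto simp del: of_real_add of_real_mult)
    then show ?thesis by blast
  next
    case False
    \<comment> \<open>The slope \<open>t = p1 / q1\<close> is available, and the powers of
      \<open>q1\<close> move into the coefficients.\<close>
    have eq: "fact d * (l1 * p1 ^ i * q1 ^ (d - i) + l2 * p2 ^ i * q2 ^ (d - i)) =
        (fact d * l1 * q1 ^ d) * (p1 / q1) ^ i + (fact d * l2 * e ^ d * q1 ^ d) * (- 1) ^ i * (p1 / q1) ^ (d - i)"
      if "i \<le> d" for i
    proof -
      have *: "q1 ^ d = q1 ^ i * q1 ^ (d - i)" using that by (simp flip: power_add)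
      show ?thesis
        using pq[OF that] False by (simp add: * power_divide field_simps)
    qed
    have "x = odeco_param d (fact d * l1 * q1 ^ d, fact d * l2 * e ^ d * q1 ^ d, p1 / q1)"
      unfolding x odeco_param_def using eq by (auto simp del: of_real_add of_real_mult)
    then show ?thesis by blast
  qed
next
  fix x assume "x \<in> range (odeco_param d)"
  then obtain a b t where x: "x = odeco_param d (a, b, t)" by auto
  define r where "r = sqrt (1 + t\<^sup>2)"
  have r2: "r\<^sup>2 = 1 + t\<^sup>2" unfolding r_def by (rule real_sqrt_pow2) (simp add: add_nonneg_nonneg)
  have t0: "1 + t\<^sup>2 \<noteq> 0" using zero_le_power2[of t] by linarith
  then have r0: "r \<noteq> 0" using r2 by auto
  have "(t / r)\<^sup>2 + (1 / r)\<^sup>2 = 1" "(- 1 / r)\<^sup>2 + (t / r)\<^sup>2 = 1" "t / r * (- 1 / r) + 1 / r * (t / r) = 0"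
    using r0 r2 t0 by (simp_all add: power_divide add.commute flip: add_divide_distrib)
  moreover have "a * t ^ i + b * (- 1) ^ i * t ^ (d - i) = fact d *
      (a * r ^ d / fact d * (t / r) ^ i * (1 / r) ^ (d - i)
        + b * r ^ d / fact d * (- 1 / r) ^ i * (t / r) ^ (d - i))" if "i \<le> d" for i
  proof -
    have *: "r ^ d = r ^ i * r ^ (d - i)" using that by (simp flip: power_add)
    show ?thesis unfolding * power_divide using r0 by (simp add: field_simps)
  qed
  then have "x = (\<lambda>i. if i \<le> d then complex_of_real (fact d *
      (a * r ^ d / fact d * (t / r) ^ i * (1 / r) ^ (d - i)
        + b * r ^ d / fact d * (- 1 / r) ^ i * (t / r) ^ (d - i))) else 0)"
    unfolding x odeco_param_def by (auto simp del: of_real_add of_real_mult of_real_divide)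
  ultimately show "x \<in> odeco_tensors d" unfolding odeco_tensors_def by blast
qed

lemma odeco_tensors_subset_aspace: "odeco_tensors d \<subseteq> aspace d"
  by (auto simp: odeco_tensors_def aspace_def)

text \<open>At a point of the parametrization both rows \<open>u\<^sub>k\<close> and \<open>u\<^bsub>k+1\<^esub> - u\<^bsub>k-1\<^esub>\<close>
  are multiples of one vector \<open>g\<close>, and the generators are \<open>2 \<times> 2\<close> minors of these rows.\<close>

lemma gens_vanish_on_odeco: "gens d \<subseteq> vanishing_ideal d (odeco_tensors d)"
proof
  fix f assume f: "f \<in> gens d"
  then obtain i j where ij: "f = gen i j" "1 \<le> i" "i < d" "2 \<le> j" "j \<le> d"
    unfolding gens_eq by blast
  have "eval_mpoly f (odeco_param d (a, b, t)) = 0" for a b t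
  proof -
    let ?x = "odeco_param d (a, b, t)"
    define g where "g k = a * t ^ (k - 1) + b * (- 1) ^ k * t ^ (d - k - 1)" for k
    have g: "?x k = of_real (t * g k)" "?x (k + 1) - ?x (k - 1) = of_real ((t\<^sup>2 - 1) * g k)"
      if k: "1 \<le> k" "k < d" for k
    proof -
      \<comment> \<open>The bounds \<open>1 <= k < d\<close> keep both exponents in \<open>g\<close>
        free of truncation.\<close>
      obtain l where l: "k = Suc l" using k by (cases k) auto
      obtain e where e: "d = Suc (k + e)" using k less_iff_Suc_add by auto
      show "?x k = of_real (t * g k)"
        unfolding odeco_param_def g_def by (simp add: l e algebra_simps)
      have "?x (k + 1) - ?x (k - 1) = of_real ((a * t ^ (k + 1) + b * (- 1) ^ (k + 1) * t ^ (d - (k + 1)))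
          - (a * t ^ (k - 1) + b * (- 1) ^ (k - 1) * t ^ (d - (k - 1))))"
        unfolding odeco_param_def using k by auto
      also have "(a * t ^ (k + 1) + b * (- 1) ^ (k + 1) * t ^ (d - (k + 1)))
          - (a * t ^ (k - 1) + b * (- 1) ^ (k - 1) * t ^ (d - (k - 1))) = (t\<^sup>2 - 1) * g k"
        unfolding g_def by (simp add: l e algebra_simps power2_eq_square)
      finally show "?x (k + 1) - ?x (k - 1) = of_real ((t\<^sup>2 - 1) * g k)" .
    qed
    have jj: "Suc (j - 1) = j" "j - 1 - 1 = j - 2" using ij by auto
    have "eval_mpoly f ?x = ?x i * (?x j - ?x (j - 2)) - ?x (j - 1) * (?x (i + 1) - ?x (i - 1))"
      by (simp add: ij(1) gen_def algebra_simps)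
    also have "?x j - ?x (j - 2) = of_real ((t\<^sup>2 - 1) * g (j - 1))"
      using g(2)[of "j - 1"] ij jj by simp
    also have "?x (j - 1) = of_real (t * g (j - 1))" using g(1) ij by simp
    also have "?x (i + 1) - ?x (i - 1) = of_real ((t\<^sup>2 - 1) * g i)" using g(2) ij by simp
    also have "?x i = of_real (t * g i)" using g(1) ij by simp
    finally show ?thesis by simp
  qed
  then show "f \<in> vanishing_ideal d (odeco_tensors d)"
    using f gens_subset_polyring[of d] unfolding vanishing_ideal_def odeco_tensors_eq by auto
qed

section \<open>Standard monomials are independent on the odeco tensors\<close>

text \<open>Apart from \<open>u_0\<close> the monomial is \<open>u_i^p u_(i+1)^q\<close> with
  \<open>p > 0\<close>, unless it is trivial. Its weight is \<open>i * (p + q) + q\<close> with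
  \<open>q < p + q\<close>, so division with remainder of the weight by the count recovers
  \<open>i\<close> and \<open>q\<close>.\<close>

lemma standard_monom_eqI:
  assumes st: "standard_monom d m" "standard_monom d n"
    and zero: "Poly_Mapping.lookup m 0 = Poly_Mapping.lookup n 0"
    and count: "wdeg (\<lambda>i. if i = 0 then 0 else 1) m = wdeg (\<lambda>i. if i = 0 then 0 else 1) n"
    and weight: "mweight m = mweight n"
  shows "m = n"
proof -
  let ?M = "wdeg (\<lambda>i. if i = 0 then 0 else 1)"
  have pos: "?M m > 0" if "k \<noteq> 0" "Poly_Mapping.lookup m k \<noteq> 0" for m k
  proof -
    have "(if k = 0 then 0 else 1) * Poly_Mapping.lookup m k \<le> ?M m"
      unfolding wdeg_def by (rule member_le_sum) (use that in \<open>auto simp: in_keys_iff\<close>)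
    then show ?thesis using that by simp
  qed
  show ?thesis
  proof (cases "?M m = 0")
    case True
    then have "Poly_Mapping.lookup m k = 0 \<and> Poly_Mapping.lookup n k = 0" if "k \<noteq> 0" for k
      using pos[OF that] count by (metis less_numeral_extra(3))
    then show ?thesis using zero by (intro poly_mapping_eqI) metis
  next
    case False
    have shape: "mweight m div ?M m \<noteq> 0 \<and> (\<forall>k. k \<noteq> 0 \<longrightarrow> Poly_Mapping.lookup m k =
        (if k = mweight m div ?M m then ?M m - mweight m mod ?M m
         else if k = Suc (mweight m div ?M m) then mweight m mod ?M m else 0))"
      if st: "standard_monom d m" and M: "?M m \<noteq> 0" for m
    proof -
      let ?S = "{k\<in>Poly_Mapping.keys m. k \<noteq> 0}"
      have "?S \<noteq> {}"
      proof
        assume "?S = {}"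
        then have "?M m = 0" by (auto simp: wdeg_def)
        then show False using M by simp
      qed
      define i where "i = Min ?S"
      have i: "i \<in> Poly_Mapping.keys m" "i \<noteq> 0"
        using Min_in[of ?S] \<open>?S \<noteq> {}\<close> unfolding i_def by auto
      have "i \<le> k" if "k \<in> Poly_Mapping.keys m" "k \<noteq> 0" for k
        unfolding i_def using that by (intro Min_le) auto
      moreover have "k < i + 2" if "k \<in> Poly_Mapping.keys m" for k
        using st i that unfolding standard_monom_def by auto
      ultimately have ks: "k = i \<or> k = Suc i" if "k \<in> Poly_Mapping.keys m" "k \<noteq> 0" for k
        using that by (metis One_nat_def Suc_1 add_Suc_right add.right_neutral le_antisym less_Suc_eq_le not_less_eq_eq)
      then have "Poly_Mapping.keys m \<subseteq> {0, i, Suc i}" by auto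
      then have "wdeg w m = (\<Sum>k\<in>{0, i, Suc i}. w k * Poly_Mapping.lookup m k)" for w
        by (intro wdeg_superset) auto
      then have wd: "wdeg w m = w 0 * Poly_Mapping.lookup m 0 + (w i * Poly_Mapping.lookup m i
          + w (Suc i) * Poly_Mapping.lookup m (Suc i))" for w
        using i by simp
      have Mm: "?M m = Poly_Mapping.lookup m i + Poly_Mapping.lookup m (Suc i)"
        using i by (simp add: wd)
      have "mweight m = i * ?M m + Poly_Mapping.lookup m (Suc i)"
        by (simp add: Mm) (simp add: mweight_eq_wdeg wd algebra_simps)
      moreover have "Poly_Mapping.lookup m (Suc i) < ?M m"
        using i by (simp add: Mm in_keys_iff)
      ultimately have "mweight m div ?M m = i" "mweight m mod ?M m = Poly_Mapping.lookup m (Suc i)"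
        using M by (simp_all add: div_mult_self3)
      then show ?thesis using i ks Mm by (auto simp: in_keys_iff)
    qed
    have "Poly_Mapping.lookup m k = Poly_Mapping.lookup n k" if "k \<noteq> 0" for k
      using shape[OF st(1) False] shape[OF st(2)] False count weight that by simp
    then show ?thesis using zero by (intro poly_mapping_eqI) metis
  qed
qed

text \<open>Uniqueness of division with remainder, used to read off the separate quantities packed
  into one degree.\<close>

lemma nat_mult_add_eqD:
  fixes c :: nat
  assumes "c * a + r = c * b + s" "r < c" "s < c"
  shows "a = b \<and> r = s"
proof -
  have "(c * a + r) div c = a" "(c * b + s) div c = b" using assms(2,3) by auto
  then have "a = b" using assms(1) by simp
  then show ?thesis using assms(1) by simp
qed

lemma degree_coeff_monom_prod:
  fixes X :: "nat \<Rightarrow> complex poly"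
  assumes "\<And>i. i \<in> Poly_Mapping.keys m \<Longrightarrow> X i \<noteq> 0 \<and> degree (X i) = E i \<and> lead_coeff (X i) = 1"
  shows "degree (\<Prod>i\<in>Poly_Mapping.keys m. X i ^ Poly_Mapping.lookup m i) = wdeg E m"
    and "coeff (\<Prod>i\<in>Poly_Mapping.keys m. X i ^ Poly_Mapping.lookup m i) (wdeg E m) = 1"
proof -
  show d: "degree (\<Prod>i\<in>Poly_Mapping.keys m. X i ^ Poly_Mapping.lookup m i) = wdeg E m"
    unfolding wdeg_def using assms
    by (subst degree_prod_eq_sum_degree) (auto simp: degree_power_eq mult.commute intro!: sum.cong)
  have "lead_coeff (\<Prod>i\<in>Poly_Mapping.keys m. X i ^ Poly_Mapping.lookup m i) = 1"
    unfolding lead_coeff_prod lead_coeff_power using assms by (intro prod.neutral ballI) (metis power_one)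
  then show "coeff (\<Prod>i\<in>Poly_Mapping.keys m. X i ^ Poly_Mapping.lookup m i) (wdeg E m) = 1"
    using d by simp
qed

text \<open>Restrict to the curve \<open>(a, b, t) = (r\<^bsup>C+(d-1)A+1\<^esup>, r\<^sup>C, r\<^sup>A)\<close>. There \<open>u\<^sub>0\<close> has
  degree \<open>C + dA\<close> in \<open>r\<close> and \<open>u\<^sub>i\<close> has degree \<open>C + (d-1+i)A + 1\<close> for \<open>i \<ge> 1\<close>. When \<open>C\<close> is large
  compared with \<open>A\<close>, and \<open>A\<close> is large, these degrees separate finitely many standard monomials.\<close>

lemma standard_vanishing_imp_zero:
  assumes d: "d \<ge> 1"
    and st: "\<forall>n\<in>Poly_Mapping.keys N. standard_monom d n"
    and van: "N \<in> vanishing_ideal d (odeco_tensors d)"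
  shows "N = 0"
proof (rule ccontr)
  assume "N \<noteq> 0"
  let ?K = "Poly_Mapping.keys N"
  let ?deg = "wdeg (\<lambda>_. 1)" and ?cnt = "wdeg (\<lambda>i. if i = 0 then 0 else 1)"
  define w where "w i = (if i = 0 then d else d - 1 + i)" for i
  \<comment> \<open>\<open>A\<close> exceeds every count and \<open>C\<close> every lower part over
    the monomials of \<open>N\<close>, so a degree splits uniquely into three digits. The second
    \<open>Suc\<close> gives \<open>A >= 2\<close>, which makes the \<open>b\<close> term of
    \<open>u_0\<close> dominate.\<close>
  define A where "A = Suc (Suc (\<Sum>m\<in>?K. ?cnt m))"
  define C where "C = Suc (\<Sum>m\<in>?K. A * wdeg w m + ?cnt m)"
  define E where "E i = C * 1 + A * w i + (if i = 0 then 0 else 1)" for i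
  have wE: "wdeg E m = C * ?deg m + A * wdeg w m + ?cnt m" for m
    unfolding E_def by (rule wdeg_linear)
  have small: "?cnt m < A" "A * wdeg w m + ?cnt m < C" if "m \<in> ?K" for m
    using member_le_sum[OF that, of ?cnt] member_le_sum[OF that, of "\<lambda>m. A * wdeg w m + ?cnt m"]
    by (auto simp: A_def C_def)
  have inj: "m = n" if mn: "m \<in> ?K" "n \<in> ?K" and "wdeg E m = wdeg E n" for m n
  proof -
    have "C * ?deg m + (A * wdeg w m + ?cnt m) = C * ?deg n + (A * wdeg w n + ?cnt n)"
      using that(3) by (simp add: wE add.assoc)
    then have e1: "?deg m = ?deg n" "A * wdeg w m + ?cnt m = A * wdeg w n + ?cnt n"
      using nat_mult_add_eqD small(2)[OF mn(1)] small(2)[OF mn(2)] by blast+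
    then have e2: "wdeg w m = wdeg w n" "?cnt m = ?cnt n"
      using nat_mult_add_eqD small(1)[OF mn(1)] small(1)[OF mn(2)] by blast+
    \<comment> \<open>The exponent of \<open>u_0\<close> is the total degree minus the count of the
      other variables; with it, \<open>wdeg w\<close> determines the weight.\<close>
    have deg: "?deg m = Poly_Mapping.lookup m 0 + ?cnt m" for m
    proof -
      have "?deg m = (\<Sum>i\<in>insert 0 (Poly_Mapping.keys m). Poly_Mapping.lookup m i)"
        by (subst wdeg_superset[of "insert 0 (Poly_Mapping.keys m)"]) auto
      moreover have "?cnt m = (\<Sum>i\<in>insert 0 (Poly_Mapping.keys m) - {0}. Poly_Mapping.lookup m i)"
        by (subst wdeg_superset[of "insert 0 (Poly_Mapping.keys m)"])
          (auto simp: sum.remove[of _ 0] intro!: sum.cong)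
      ultimately show ?thesis by (simp add: sum.remove[of _ 0])
    qed
    have wt: "wdeg w m = (d - 1) * ?deg m + mweight m + Poly_Mapping.lookup m 0" for m
    proof -
      have "w = (\<lambda>i. (d - 1) * 1 + 1 * i + (if i = 0 then 1 else 0))"
        using d by (auto simp: w_def fun_eq_iff)
      moreover have "wdeg (\<lambda>i. if i = 0 then 1 else 0) m = Poly_Mapping.lookup m 0"
        by (subst wdeg_superset[of "insert 0 (Poly_Mapping.keys m)"])
          (auto simp: sum.remove[of _ 0] intro!: sum.neutral)
      ultimately show ?thesis using wdeg_linear[of "d - 1" "\<lambda>_. 1" 1 "\<lambda>i. i"]
        by (simp add: mweight_eq_wdeg)
    qed
    have z: "Poly_Mapping.lookup m 0 = Poly_Mapping.lookup n 0"
      using deg[of m] deg[of n] e1(1) e2(2) by simp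
    then have "mweight m = mweight n" using wt[of m] wt[of n] e1(1) e2(1) by simp
    then show "m = n" using st mn z e2(2) by (intro standard_monom_eqI[of d]) auto
  qed
  \<comment> \<open>The exponent of \<open>a\<close> is one more than the largest degree of a
    \<open>b\<close> term with \<open>i >= 1\<close>. Hence the \<open>a\<close> term dominates for
    \<open>i >= 1\<close>, while the \<open>b\<close> term dominates for
    \<open>i = 0\<close>.\<close>
  define B where "B = C + (d - 1) * A + 1"
  define X :: "nat \<Rightarrow> complex poly" where
    "X i = (if i \<le> d then monom 1 (B + i * A) + monom ((- 1) ^ i) (C + (d - i) * A) else 0)" for i
  have X: "X i \<noteq> 0 \<and> degree (X i) = E i \<and> lead_coeff (X i) = 1" if "i \<le> d" for i
  proof (cases "i = 0")
    case True
    have "C + d * A = B - 1 + A" using d by (cases d) (auto simp: B_def)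
    then have lt: "B < C + d * A" by (simp add: B_def A_def)
    have Xi: "X i = monom 1 (C + d * A) + monom 1 B" by (simp add: X_def True add.commute)
    have Ei: "E i = C + d * A" by (simp add: E_def w_def True)
    have "degree (X i) = E i"
      unfolding Xi Ei using lt by (subst degree_add_eq_left) (auto simp: degree_monom_eq)
    moreover have "coeff (X i) (E i) = 1" unfolding Xi Ei using lt by simp
    ultimately show ?thesis by (metis coeff_0 zero_neq_one)
  next
    case False
    have "(d - i) * A \<le> (d - 1) * A" using False by (intro mult_right_mono) auto
    then have lt: "C + (d - i) * A < B + i * A" unfolding B_def by linarith
    have Xi: "X i = monom 1 (B + i * A) + monom ((- 1) ^ i) (C + (d - i) * A)"
      using that by (simp add: X_def)
    have Ei: "E i = B + i * A" using False by (simp add: E_def w_def B_def algebra_simps)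
    have "degree (X i) = E i"
      unfolding Xi Ei using lt
      by (subst degree_add_eq_left) (auto simp: degree_monom_eq intro: le_less_trans[OF degree_monom_le])
    moreover have "coeff (X i) (E i) = 1" unfolding Xi Ei using lt by simp
    ultimately show ?thesis by (metis coeff_0 zero_neq_one)
  qed
  define T where "T m = (\<Prod>i\<in>Poly_Mapping.keys m. X i ^ Poly_Mapping.lookup m i)" for m :: monom
  define P where "P = (\<Sum>m\<in>?K. smult (Poly_Mapping.lookup N m) (T m))"
  have T: "degree (T m) = wdeg E m" "coeff (T m) (wdeg E m) = 1" if "m \<in> ?K" for m
  proof -
    have "X i \<noteq> 0 \<and> degree (X i) = E i \<and> lead_coeff (X i) = 1" if "i \<in> Poly_Mapping.keys m" for i
      using X st \<open>m \<in> ?K\<close> that unfolding standard_monom_def by blast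
    then show "degree (T m) = wdeg E m" "coeff (T m) (wdeg E m) = 1"
      unfolding T_def by (rule degree_coeff_monom_prod; blast)+
  qed
  have "poly P (of_real r) = 0" for r :: real
  proof -
    have "(\<lambda>i. poly (X i) (of_real r)) = odeco_param d (r ^ B, r ^ C, r ^ A)"
      by (auto simp: fun_eq_iff X_def odeco_param_def poly_monom power_add power_mult mult.commute
          simp flip: power_mult)
    then have "poly P (of_real r) = eval_mpoly N (odeco_param d (r ^ B, r ^ C, r ^ A))"
      unfolding P_def T_def eval_mpoly_def eval_monom_def
      by (simp add: poly_sum poly_prod fun_eq_iff)
    then show ?thesis using van by (auto simp: vanishing_ideal_def odeco_tensors_eq)
  qed
  then have "P = 0" by (rule poly_eq_0_if_zero_on_reals)
  \<comment> \<open>The degrees are pairwise distinct, so the coefficient at the largest one comes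
    from a single monomial.\<close>
  obtain m where m: "m \<in> ?K" "\<forall>n\<in>?K. wdeg E n \<le> wdeg E m"
    using Max_in[of "wdeg E ` ?K"] Max_ge[of "wdeg E ` ?K"] \<open>N \<noteq> 0\<close>
    by (smt (verit, best) finite_imageI finite_keys imageE image_eqI image_is_empty keys_eq_empty)
  have "coeff P (wdeg E m) = (\<Sum>n\<in>?K. if n = m then Poly_Mapping.lookup N m else 0)"
    unfolding P_def coeff_sum coeff_smult
  proof (rule sum.cong)
    fix n assume n: "n \<in> ?K"
    show "Poly_Mapping.lookup N n * coeff (T n) (wdeg E m) = (if n = m then Poly_Mapping.lookup N m else 0)"
    proof (cases "n = m")
      case False
      then have "wdeg E n < wdeg E m" using m n inj by (metis nat_less_le)
      then show ?thesis using T[OF n] False by (simp add: coeff_eq_0)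
    qed (use T(2)[OF n] in simp)
  qed simp
  also have "\<dots> = Poly_Mapping.lookup N m" using m by simp
  finally show False using \<open>P = 0\<close> m by (simp add: in_keys_iff)
qed

section \<open>The ideal, its Groebner basis, and primality\<close>

text \<open>A polynomial vanishing on the tensors is congruent modulo the generators to a
  combination of standard monomials. That combination vanishes there too, so it is zero.\<close>

lemma ideal_gens_eq_vanishing:
  assumes "d \<ge> 1"
  shows "ideal_gen d (gens d) = vanishing_ideal d (odeco_tensors d)"
proof
  let ?K = "vanishing_ideal d (odeco_tensors d)"
  show sub: "ideal_gen d (gens d) \<subseteq> ?K"
    by (rule ideal_gen_least[OF is_ideal_vanishing_ideal gens_vanish_on_odeco])
  show "?K \<subseteq> ideal_gen d (gens d)"
  proof
    fix p assume p: "p \<in> ?K"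
    then have "p \<in> polyring d" by (simp add: vanishing_ideal_def)
    then obtain N where N: "\<forall>n\<in>Poly_Mapping.keys N. standard_monom d n" "p - N \<in> ideal_gen d (gens d)"
      by (rule reduces_to_standard)
    have "p - (p - N) \<in> ?K"
      using ideal_diff[OF is_ideal_vanishing_ideal p] N(2) sub by blast
    then have "N = 0" using standard_vanishing_imp_zero[OF assms N(1)] by simp
    then show "p \<in> ideal_gen d (gens d)" using N(2) by simp
  qed
qed

text \<open>A standard leading monomial would leave a nonzero remainder vanishing on the tensors,
  which is impossible. Otherwise the leading monomial contains some \<open>u_i u_j\<close> with
  \<open>1 <= i\<close> and \<open>i + 2 <= j\<close>, the leading monomial of
  \<open>gen i j\<close>.\<close>

lemma groebner_basis_gens:
  assumes "d \<ge> 1"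
  shows "groebner_basis (gens d) (ideal_gen d (gens d))"
  unfolding groebner_basis_def
proof (intro conjI ballI impI)
  let ?K = "vanishing_ideal d (odeco_tensors d)"
  show "gens d \<subseteq> ideal_gen d (gens d)" by (rule ideal_gen_base)
  fix f assume f: "f \<in> ideal_gen d (gens d)" "f \<noteq> 0"
  then have fK: "f \<in> ?K" and fR: "f \<in> polyring d"
    using ideal_gens_eq_vanishing[OF assms] by (auto simp: vanishing_ideal_def)
  show "\<exists>g\<in>gens d. g \<noteq> 0 \<and> monom_dvd (lead_monom g) (lead_monom f)"
  proof (cases "standard_monom d (lead_monom f)")
    case True
    obtain N where N: "\<forall>n\<in>Poly_Mapping.keys N. standard_monom d n" "f - N \<in> ideal_gen d (gens d)" "N \<noteq> 0"
      using reduces_to_standard[OF fR] f(2) True by metis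
    have "f - (f - N) \<in> ?K"
      using ideal_diff[OF is_ideal_vanishing_ideal fK] N(2) ideal_gens_eq_vanishing[OF assms] by blast
    then have "N = 0" using standard_vanishing_imp_zero[OF assms N(1)] by simp
    then show ?thesis using N(3) by simp
  next
    case False
    have "Poly_Mapping.keys (lead_monom f) \<subseteq> {..d}"
      using lead_monom_is_max(1)[OF f(2)] fR by (auto simp: polyring_def)
    with False obtain i j where ij: "i \<in> Poly_Mapping.keys (lead_monom f)"
      "j \<in> Poly_Mapping.keys (lead_monom f)" "1 \<le> i" "i + 2 \<le> j" "j \<le> d"
      by (auto simp: standard_monom_def not_less)
    then have "gen i j \<in> gens d" unfolding gens_eq by force
    then show ?thesis
      using lead_monom_gen[OF ij(3,4)] quad_dvdD(1)[OF ij(1,2)] ij(4) by (intro bexI[of _ "gen i j"]) auto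
  qed
qed

text \<open>The prime condition for functions on \<open>S\<close>, phrased for arbitrary point sets
  so that it applies to the real tensors before closing up.\<close>

definition irred_on :: "nat \<Rightarrow> (nat \<Rightarrow> complex) set \<Rightarrow> bool" where
  "irred_on d S \<longleftrightarrow> (\<forall>f\<in>polyring d. \<forall>g\<in>polyring d. (\<forall>x\<in>S. eval_mpoly f x * eval_mpoly g x = 0) \<longrightarrow>
     (\<forall>x\<in>S. eval_mpoly f x = 0) \<or> (\<forall>x\<in>S. eval_mpoly g x = 0))"

text \<open>If \<open>f\<close> is nonzero at \<open>a\<close> and \<open>g\<close> at
  \<open>b\<close>, both restrict to nonzero polynomials on a curve through the two points. Their
  product is then nonzero, yet it vanishes at all real parameters.\<close>

lemma irred_on_if_joined_by_curves:
  assumes "\<And>a b. a \<in> S \<Longrightarrow> b \<in> S \<Longrightarrow> \<exists>X :: nat \<Rightarrow> complex poly. (\<lambda>i. poly (X i) 0) = a \<and>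
    (\<lambda>i. poly (X i) 1) = b \<and> (\<forall>r :: real. (\<lambda>i. poly (X i) (of_real r)) \<in> S)"
  shows "irred_on d S"
  unfolding irred_on_def
proof (intro ballI impI, rule ccontr)
  fix f g assume fg: "\<forall>x\<in>S. eval_mpoly f x * eval_mpoly g x = 0"
    and "\<not> ((\<forall>x\<in>S. eval_mpoly f x = 0) \<or> (\<forall>x\<in>S. eval_mpoly g x = 0))"
  then obtain a b where a: "a \<in> S" "eval_mpoly f a \<noteq> 0" and b: "b \<in> S" "eval_mpoly g b \<noteq> 0" by blast
  obtain X :: "nat \<Rightarrow> complex poly" where X: "(\<lambda>i. poly (X i) 0) = a" "(\<lambda>i. poly (X i) 1) = b"
    "\<And>r :: real. (\<lambda>i. poly (X i) (of_real r)) \<in> S"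
    using assms[OF a(1) b(1)] by blast
  obtain F where F: "\<And>s. poly F s = eval_mpoly f (\<lambda>i. poly (X i) s)"
    using eval_mpoly_on_curve[of f X] by blast
  obtain G where G: "\<And>s. poly G s = eval_mpoly g (\<lambda>i. poly (X i) s)"
    using eval_mpoly_on_curve[of g X] by blast
  have "poly F 0 \<noteq> 0" "poly G 1 \<noteq> 0" using F G X a b by auto
  then have "F * G \<noteq> 0" by auto
  moreover have "poly (F * G) (of_real r) = 0" for r :: real
    using F G X(3)[of r] fg by simp
  ultimately show False using poly_eq_0_if_zero_on_reals by blast
qed

lemma irred_on_odeco: "irred_on d (odeco_tensors d)"
proof (rule irred_on_if_joined_by_curves)
  fix x y assume "x \<in> odeco_tensors d" "y \<in> odeco_tensors d"
  then obtain a b t a' b' t' where x: "x = odeco_param d (a, b, t)" and y: "y = odeco_param d (a', b', t')"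
    unfolding odeco_tensors_eq by auto
  define line where "line p q = [:complex_of_real p, complex_of_real (q - p):]" for p q
  define X where "X i = (if i \<le> d then line a a' * line t t' ^ i
      + smult ((- 1) ^ i) (line b b' * line t t' ^ (d - i)) else 0)" for i
  have X: "(\<lambda>i. poly (X i) (of_real r)) =
      odeco_param d (a + r * (a' - a), b + r * (b' - b), t + r * (t' - t))" for r
  proof
    fix i
    have "poly (line p q) (of_real r) = of_real (p + r * (q - p))" for p q
      by (simp add: line_def)
    then show "poly (X i) (of_real r) =
        odeco_param d (a + r * (a' - a), b + r * (b' - b), t + r * (t' - t)) i"
      by (simp add: X_def odeco_param_def mult_ac)
  qed
  show "\<exists>X :: nat \<Rightarrow> complex poly. (\<lambda>i. poly (X i) 0) = x \<and>
    (\<lambda>i. poly (X i) 1) = y \<and> (\<forall>r :: real. (\<lambda>i. poly (X i) (of_real r)) \<in> odeco_tensors d)"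
    using X X[of 0] X[of 1] by (intro exI[of _ X]) (simp add: x y odeco_tensors_eq)
qed

lemma prime_ideal_vanishing_odeco: "prime_ideal d (vanishing_ideal d (odeco_tensors d))"
proof -
  have "1 \<notin> vanishing_ideal d (odeco_tensors d)"
    by (auto simp: vanishing_ideal_def odeco_tensors_eq)
  then have "vanishing_ideal d (odeco_tensors d) \<noteq> polyring d"
    using polyring_one by blast
  moreover have "f \<in> vanishing_ideal d (odeco_tensors d) \<or> g \<in> vanishing_ideal d (odeco_tensors d)"
    if "f \<in> polyring d" "g \<in> polyring d" "f * g \<in> vanishing_ideal d (odeco_tensors d)" for f g
    using irred_on_odeco[of d] that unfolding irred_on_def vanishing_ideal_def by simp
  ultimately show ?thesis
    unfolding prime_ideal_def using is_ideal_vanishing_ideal by blast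
qed

section \<open>Irreducible closed sets and a chain of length three\<close>

text \<open>The last hypothesis says that \<open>S\<close> is dense in \<open>Z\<close>. If
  \<open>A\<close> and \<open>B\<close> were both proper, some equation of each would fail on
  \<open>Z\<close>, although the product of the two vanishes on \<open>S\<close>.\<close>

lemma irreducible_closedI:
  assumes "zariski_closed d Z" "S \<subseteq> Z" "S \<noteq> {}" "irred_on d S"
    and "\<And>f. f \<in> polyring d \<Longrightarrow> \<forall>x\<in>S. eval_mpoly f x = 0 \<Longrightarrow> \<forall>x\<in>Z. eval_mpoly f x = 0"
  shows "irreducible_closed d Z"
  unfolding irreducible_closed_def
proof (intro conjI allI impI)
  show "zariski_closed d Z" by fact
  show "Z \<noteq> {}" using assms by blast
  fix A B assume AB: "zariski_closed d A \<and> zariski_closed d B \<and> Z = A \<union> B"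
  then obtain SA SB where SA: "SA \<subseteq> polyring d" "A = zero_set d SA" and SB: "SB \<subseteq> polyring d" "B = zero_set d SB"
    by (auto simp: zariski_closed_def)
  have Z_sub: "Z \<subseteq> aspace d" using assms(1) by (auto simp: zariski_closed_def zero_set_def)
  show "Z = A \<or> Z = B"
  proof (rule ccontr)
    assume "\<not> (Z = A \<or> Z = B)"
    then obtain x y where x: "x \<in> Z" "x \<notin> A" and y: "y \<in> Z" "y \<notin> B" using AB by blast
    obtain f where f: "f \<in> SA" "eval_mpoly f x \<noteq> 0" using x SA Z_sub by (auto simp: zero_set_def)
    obtain g where g: "g \<in> SB" "eval_mpoly g y \<noteq> 0" using y SB Z_sub by (auto simp: zero_set_def)
    have "\<forall>z\<in>S. eval_mpoly f z * eval_mpoly g z = 0"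
      using assms(2) AB f g SA SB by (auto simp: zero_set_def)
    then have "(\<forall>z\<in>S. eval_mpoly f z = 0) \<or> (\<forall>z\<in>S. eval_mpoly g z = 0)"
      using assms(4) f g SA SB unfolding irred_on_def by blast
    then show False using assms(5) f g x y SA SB by blast
  qed
qed

text \<open>When the product vanishes, \<open>Z\<close> is the union of its closed parts where
  \<open>f\<close> or \<open>g\<close> vanishes.\<close>

lemma irreducible_closed_imp_irred_on:
  assumes "irreducible_closed d Z"
  shows "irred_on d Z"
  unfolding irred_on_def
proof (intro ballI impI)
  fix f g assume fg: "f \<in> polyring d" "g \<in> polyring d" "\<forall>x\<in>Z. eval_mpoly f x * eval_mpoly g x = 0"
  obtain S where S: "S \<subseteq> polyring d" "Z = zero_set d S"
    using assms by (auto simp: irreducible_closed_def zariski_closed_def)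
  have "Z = zero_set d (insert f S) \<union> zero_set d (insert g S)"
    using fg S by (auto simp: zero_set_def)
  moreover have "zariski_closed d (zero_set d (insert f S))" "zariski_closed d (zero_set d (insert g S))"
    using fg S by (auto intro!: zariski_closed_zero_set)
  ultimately have "Z = zero_set d (insert f S) \<or> Z = zero_set d (insert g S)"
    using assms unfolding irreducible_closed_def by blast
  then show "(\<forall>x\<in>Z. eval_mpoly f x = 0) \<or> (\<forall>x\<in>Z. eval_mpoly g x = 0)"
    by (auto simp: zero_set_def)
qed

lemma irreducible_closed_odeco:
  assumes "d \<ge> 1"
  shows "irreducible_closed d (zero_set d (ideal_gen d (gens d)))"
proof (rule irreducible_closedI[OF _ _ _ irred_on_odeco])
  show "zariski_closed d (zero_set d (ideal_gen d (gens d)))"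
    by (rule zariski_closed_zero_set)
      (use is_ideal_ideal_gen[OF gens_subset_polyring] in \<open>auto simp: is_ideal_in_def\<close>)
  show "odeco_tensors d \<subseteq> zero_set d (ideal_gen d (gens d))"
    unfolding ideal_gens_eq_vanishing[OF assms]
    using odeco_tensors_subset_aspace by (auto simp: zero_set_def vanishing_ideal_def)
  show "odeco_tensors d \<noteq> {}" by (simp add: odeco_tensors_eq)
  show "\<forall>x\<in>zero_set d (ideal_gen d (gens d)). eval_mpoly f x = 0"
    if "f \<in> polyring d" "\<forall>x\<in>odeco_tensors d. eval_mpoly f x = 0" for f
    unfolding ideal_gens_eq_vanishing[OF assms]
    using that by (auto simp: zero_set_def vanishing_ideal_def)
qed

section \<open>Coordinate subspaces inside the variety\<close>

definition coord_subspace :: "nat set \<Rightarrow> (nat \<Rightarrow> complex) set" where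
  "coord_subspace T = {x. \<forall>i. i \<notin> T \<longrightarrow> x i = 0}"

lemma irreducible_closed_coord_subspace:
  assumes "T \<subseteq> {..d}"
  shows "irreducible_closed d (coord_subspace T)"
proof (rule irreducible_closedI[where S = "coord_subspace T"])
  have "coord_subspace T = zero_set d (Var ` ({..d} - T))"
  proof (intro equalityI subsetI)
    fix x assume "x \<in> zero_set d (Var ` ({..d} - T))"
    then have "x i = 0" if "i \<notin> T" for i
      using that by (cases "i \<le> d") (auto simp: zero_set_def aspace_def)
    then show "x \<in> coord_subspace T" by (simp add: coord_subspace_def)
  qed (use assms in \<open>auto simp: coord_subspace_def zero_set_def aspace_def\<close>)
  then show "zariski_closed d (coord_subspace T)"
    by (auto intro!: zariski_closed_zero_set polyring_Var)
  show "coord_subspace T \<noteq> {}" by (auto simp: coord_subspace_def)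
  show "irred_on d (coord_subspace T)"
  proof (rule irred_on_if_joined_by_curves)
    fix a b assume "a \<in> coord_subspace T" "b \<in> coord_subspace T"
    then show "\<exists>X :: nat \<Rightarrow> complex poly. (\<lambda>i. poly (X i) 0) = a \<and>
      (\<lambda>i. poly (X i) 1) = b \<and> (\<forall>r :: real. (\<lambda>i. poly (X i) (of_real r)) \<in> coord_subspace T)"
      by (intro exI[of _ "\<lambda>i. [:a i, b i - a i:]"]) (auto simp: coord_subspace_def)
  qed
qed auto

text \<open>Every term of \<open>gen i j\<close> contains \<open>u_i\<close> or
  \<open>u_(j-1)\<close>, whose indices lie strictly between \<open>0\<close> and
  \<open>d\<close>.\<close>

lemma coord_subspace_subset_zero_set:
  assumes "T \<subseteq> {0, d}"
  shows "coord_subspace T \<subseteq> zero_set d (ideal_gen d (gens d))"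
  unfolding zero_set_ideal_gen[OF gens_subset_polyring]
proof
  fix x assume x: "x \<in> coord_subspace T"
  then have x0: "x k = 0" if "k \<noteq> 0" "k \<noteq> d" for k
    using assms that by (auto simp: coord_subspace_def)
  have "eval_mpoly f x = 0" if f: "f \<in> gens d" for f
  proof -
    obtain i j where ij: "f = gen i j" "1 \<le> i" "i < d" "2 \<le> j" "j \<le> d"
      using f unfolding gens_eq by blast
    then have "x i = 0" "x (j - 1) = 0" by (auto intro!: x0)
    then show ?thesis by (simp add: ij(1) gen_def)
  qed
  moreover have "x \<in> aspace d" using x assms by (auto simp: aspace_def coord_subspace_def)
  ultimately show "x \<in> zero_set d (gens d)" by (simp add: zero_set_def)
qed

text \<open>The chain consists of the origin, the axis of \<open>u_0\<close>, the plane of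
  \<open>u_0\<close> and \<open>u_d\<close>, and the whole variety.\<close>

lemma irr_chain_3:
  assumes "d \<ge> 2"
  shows "irr_chain d (zero_set d (ideal_gen d (gens d))) 3"
proof -
  let ?V = "zero_set d (ideal_gen d (gens d))"
  let ?e = "\<lambda>k i. if i = k then 1 else 0 :: complex"
  define Z where "Z k = (if k = 0 then coord_subspace {} else if k = 1 then coord_subspace {0}
      else if k = 2 then coord_subspace {0, d} else ?V)" for k :: nat
  have sub: "coord_subspace {0, d} \<subset> ?V"
  proof -
    \<comment> \<open>All coordinates of this tensor are 1, and for \<open>d >= 2\<close> the
      coordinate \<open>u_1\<close> must vanish on the plane.\<close>
    have "odeco_param d (1, 0, 1) \<in> ?V"
      using odeco_tensors_subset_aspace[of d] assms
      unfolding ideal_gens_eq_vanishing[OF order.trans[OF one_le_numeral assms]] odeco_tensors_eq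
      by (auto simp: zero_set_def vanishing_ideal_def)
    moreover have "odeco_param d (1, 0, 1) \<notin> coord_subspace {0, d}"
      using assms by (auto simp: odeco_param_def coord_subspace_def intro!: exI[of _ 1])
    ultimately show ?thesis using coord_subspace_subset_zero_set[of "{0, d}" d] by blast
  qed
  have "coord_subspace {} \<subset> coord_subspace {0}"
  proof -
    have "?e 0 \<in> coord_subspace {0} - coord_subspace {}" by (auto simp: coord_subspace_def)
    then show ?thesis by (auto simp: coord_subspace_def)
  qed
  moreover have "coord_subspace {0} \<subset> coord_subspace {0, d}"
  proof -
    have "?e d \<in> coord_subspace {0, d} - coord_subspace {0}"
      using assms by (auto simp: coord_subspace_def)
    moreover have "coord_subspace {0} \<subseteq> coord_subspace {0, d}"
      by (auto simp: coord_subspace_def)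
    ultimately show ?thesis by blast
  qed
  ultimately have "Z k \<subset> Z (Suc k)" if "k < 3" for k
    using sub that by (auto simp: Z_def less_Suc_eq numeral_3_eq_3)
  moreover have "irreducible_closed d (Z k) \<and> Z k \<subseteq> ?V" if "k \<le> 3" for k
    using irreducible_closed_odeco[of d] assms coord_subspace_subset_zero_set[of _ d]
    by (auto simp: Z_def intro!: irreducible_closed_coord_subspace)
  ultimately show ?thesis unfolding irr_chain_def by blast
qed

section \<open>Upper bound for the dimension\<close>

lemma eval_mpoly_power [simp]: "eval_mpoly (p ^ n) x = eval_mpoly p x ^ n"
  by (induction n) auto

lemma polyring_power: "p \<in> polyring d \<Longrightarrow> p ^ n \<in> polyring d"
  by (induction n) (auto simp: polyring_one polyring_mult)

text \<open>The head of the list is the exponent of the last function, so a list of length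
  \<open>k\<close> uses \<open>f 0\<close> to \<open>f (k - 1)\<close> and extending the chain is a
  \<open>Cons\<close>.\<close>

fun power_product :: "(nat \<Rightarrow> mpoly) \<Rightarrow> nat list \<Rightarrow> mpoly" where
  "power_product f [] = 1"
| "power_product f (j # l) = f (length l) ^ j * power_product f l"

definition exponents :: "nat \<Rightarrow> nat \<Rightarrow> nat list set" where
  "exponents n k = {l. set l \<subseteq> {..<n} \<and> length l = k}"

lemma finite_exponents: "finite (exponents n k)"
  unfolding exponents_def by (rule finite_lists_length_eq) simp

lemma card_exponents: "card (exponents n k) = n ^ k"
  unfolding exponents_def by (simp add: card_lists_length_eq)

lemma exponents_0: "exponents n 0 = {[]}"
  by (auto simp: exponents_def)

lemma sum_exponents_Suc:
  "(\<Sum>l\<in>exponents n (Suc k). h l) = (\<Sum>j<n. \<Sum>l\<in>exponents n k. h (j # l))"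
proof -
  have "exponents n (Suc k) = (\<lambda>(j, l). j # l) ` ({..<n} \<times> exponents n k)"
    by (force simp: exponents_def image_iff length_Suc_conv)
  moreover have "inj_on (\<lambda>(j, l). j # l) ({..<n} \<times> exponents n k)"
    by (auto simp: inj_on_def)
  ultimately show ?thesis
    by (simp add: sum.reindex sum.cartesian_product case_prod_unfold)
qed

lemma polyring_power_product:
  "(\<And>i. i < length l \<Longrightarrow> f i \<in> polyring d) \<Longrightarrow> power_product f l \<in> polyring d"
  by (induction l) (auto intro: polyring_one polyring_mult polyring_power)

text \<open>Modulo \<open>f\<close> only the part of exponent \<open>0\<close> survives on \<open>Z\<close>; on \<open>Z'\<close> a factor \<open>f\<close> can be cancelled.\<close>

lemma powers_independent:
  assumes Z: "Z \<subseteq> Z'" "irred_on d Z'" and f: "f \<in> polyring d" "\<forall>x\<in>Z. eval_mpoly f x = 0"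
      "\<not> (\<forall>x\<in>Z'. eval_mpoly f x = 0)"
    and q: "\<And>s. s \<in> S \<Longrightarrow> q s \<in> polyring d"
    and ind: "\<And>c. \<forall>x\<in>Z. (\<Sum>s\<in>S. c s * eval_mpoly (q s) x) = 0 \<Longrightarrow> \<forall>s\<in>S. c s = 0"
    and eq: "\<forall>x\<in>Z'. (\<Sum>j<n. \<Sum>s\<in>S. c j s * (eval_mpoly f x ^ j * eval_mpoly (q s) x)) = 0"
  shows "\<forall>j<n. \<forall>s\<in>S. c j s = 0"
  using eq
proof (induction n arbitrary: c)
  case (Suc n)
  let ?f = "eval_mpoly f" and ?q = "\<lambda>s. eval_mpoly (q s)"
  have split: "(\<Sum>s\<in>S. c 0 s * ?q s x) +
      ?f x * (\<Sum>j<n. \<Sum>s\<in>S. c (Suc j) s * (?f x ^ j * ?q s x)) = 0" if "x \<in> Z'" for x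
  proof -
    have "(\<Sum>j<Suc n. \<Sum>s\<in>S. c j s * (?f x ^ j * ?q s x)) = 0" using Suc.prems that by blast
    then show ?thesis
      unfolding sum.lessThan_Suc_shift by (simp add: sum_distrib_left mult_ac)
  qed
  have "\<forall>x\<in>Z. (\<Sum>s\<in>S. c 0 s * ?q s x) = 0"
  proof
    fix x assume "x \<in> Z"
    then show "(\<Sum>s\<in>S. c 0 s * ?q s x) = 0"
      using split[of x] f(2) Z(1) by auto
  qed
  then have c0: "\<forall>s\<in>S. c 0 s = 0" by (rule ind)
  define P where "P = (\<Sum>j<n. \<Sum>s\<in>S. Poly_Mapping.single 0 (c (Suc j) s) * (f ^ j * q s))"
  have P: "P \<in> polyring d"
    unfolding P_def by (intro polyring_sum polyring_mult polyring_const polyring_power f q)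
  have eval_P: "eval_mpoly P x = (\<Sum>j<n. \<Sum>s\<in>S. c (Suc j) s * (?f x ^ j * ?q s x))" for x
    by (simp add: P_def)
  have "\<forall>x\<in>Z'. eval_mpoly f x * eval_mpoly P x = 0"
    using split c0 by (simp add: eval_P)
  then have "\<forall>x\<in>Z'. eval_mpoly P x = 0"
    using Z(2) f P unfolding irred_on_def by blast
  then have "\<forall>j<n. \<forall>s\<in>S. c (Suc j) s = 0"
    unfolding eval_P by (rule Suc.IH)
  then show ?case using c0 less_Suc_eq_0_disj by auto
qed simp

text \<open>Induction along the chain: each \<open>f K\<close> vanishes on \<open>Z K\<close> but
  not on the next irreducible set, so adjoining its powers preserves independence. At the start only
  the constant 1 is present, and \<open>Z 0\<close> has a point.\<close>

lemma chain_power_products_independent: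
  assumes "Z 0 \<noteq> {}"
    and "\<And>k. k < K \<Longrightarrow> Z k \<subseteq> Z (Suc k) \<and> irred_on d (Z (Suc k)) \<and> f k \<in> polyring d \<and>
      (\<forall>x\<in>Z k. eval_mpoly (f k) x = 0) \<and> \<not> (\<forall>x\<in>Z (Suc k). eval_mpoly (f k) x = 0)"
    and "\<forall>x\<in>Z K. (\<Sum>l\<in>exponents n K. c l * eval_mpoly (power_product f l) x) = 0"
  shows "\<forall>l\<in>exponents n K. c l = 0"
  using assms(2,3)
proof (induction K arbitrary: c)
  case 0
  then show ?case using assms(1) by (auto simp: exponents_0)
next
  case (Suc K)
  have "\<forall>j<n. \<forall>l\<in>exponents n K. c (j # l) = 0"
  proof (rule powers_independent[where Z = "Z K" and Z' = "Z (Suc K)" and f = "f K" and q = "power_product f"])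
    show "\<forall>s\<in>exponents n K. c s = 0"
      if "\<forall>x\<in>Z K. (\<Sum>s\<in>exponents n K. c s * eval_mpoly (power_product f s) x) = 0" for c
      using Suc.IH[OF Suc.prems(1) that] by simp
    show "power_product f l \<in> polyring d" if "l \<in> exponents n K" for l
      using that Suc.prems(1) by (intro polyring_power_product) (auto simp: exponents_def)
    have "(\<Sum>l\<in>exponents n (Suc K). c l * eval_mpoly (power_product f l) x) =
        (\<Sum>j<n. \<Sum>l\<in>exponents n K. c (j # l) * (eval_mpoly (f K) x ^ j * eval_mpoly (power_product f l) x))" for x
      unfolding sum_exponents_Suc by (intro sum.cong) (auto simp: exponents_def)
    then show "\<forall>x\<in>Z (Suc K). (\<Sum>j<n. \<Sum>l\<in>exponents n K.
        c (j # l) * (eval_mpoly (f K) x ^ j * eval_mpoly (power_product f l) x)) = 0"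
      using Suc.prems(2) by simp
  qed (use Suc.prems(1)[of K] in auto)
  then show ?case by (auto simp: exponents_def length_Suc_conv)
qed

section \<open>Linear dependence among complex-valued functions\<close>

interpretation fun_space: vector_space "\<lambda>(c :: complex) (g :: 'p \<Rightarrow> complex) x. c * g x"
  by unfold_locales (simp_all add: fun_eq_iff algebra_simps)

lemma sum_apply: "(\<Sum>a\<in>A. h a) x = (\<Sum>a\<in>A. h a x)"
  for h :: "'a \<Rightarrow> 'p \<Rightarrow> complex"
  by (induction A rule: infinite_finite_induct) auto

text \<open>The family may repeat a function. A repetition gives a relation with coefficients 1 and
  -1; otherwise there are more vectors than the span of \<open>T\<close> permits to be
  independent.\<close>

lemma linear_dependence:
  fixes g :: "'s \<Rightarrow> 'p \<Rightarrow> complex"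
  assumes S: "finite S" and T: "finite T" "card T < card S"
    and span: "\<And>s. s \<in> S \<Longrightarrow> g s \<in> fun_space.span T"
  shows "\<exists>c. (\<exists>s\<in>S. c s \<noteq> 0) \<and> (\<forall>x. (\<Sum>s\<in>S. c s * g s x) = 0)"
proof (cases "inj_on g S")
  case False
  then obtain s t where st: "s \<in> S" "t \<in> S" "s \<noteq> t" "g s = g t" by (auto simp: inj_on_def)
  let ?c = "\<lambda>r. (if r = s then 1 else 0) - (if r = t then 1 else 0) :: complex"
  have "(\<Sum>r\<in>S. ?c r * g r x) = (\<Sum>r\<in>S. if r = s then g s x else 0) - (\<Sum>r\<in>S. if r = t then g t x else 0)" for x
    unfolding sum_subtractf[symmetric] by (intro sum.cong) auto
  then have "(\<Sum>r\<in>S. ?c r * g r x) = 0" for x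
    using st S by simp
  then show ?thesis using st by (intro exI[of _ ?c]) auto
next
  case True
  have "fun_space.dependent (g ` S)"
  proof (rule ccontr)
    assume "\<not> fun_space.dependent (g ` S)"
    then have "card (g ` S) \<le> card T"
      using fun_space.independent_span_bound[OF T(1), of "g ` S"] span by auto
    then show False using T(2) card_image[OF True] by simp
  qed
  then obtain c where c: "\<exists>v\<in>g ` S. c v \<noteq> 0" "(\<Sum>v\<in>g ` S. (\<lambda>x. c v * v x)) = 0"
    using fun_space.dependent_finite[of "g ` S"] S by auto
  have "(\<Sum>s\<in>S. c (g s) * g s x) = (\<Sum>v\<in>g ` S. (\<lambda>x. c v * v x)) x" for x
    by (simp add: sum.reindex[OF True] sum_apply)
  then show ?thesis using c by (intro exI[of _ "\<lambda>s. c (g s)"]) auto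
qed

section \<open>Polynomial functions of the three parameters\<close>

definition param_monom :: "nat \<times> nat \<times> nat \<Rightarrow> real \<times> real \<times> real \<Rightarrow> complex" where
  "param_monom = (\<lambda>(i, j, k) (a, b, t). of_real (a ^ i * b ^ j * t ^ k))"

text \<open>The three degrees are bounded separately, so \<open>(M + 1)^3\<close> monomials
  span.\<close>

definition param_polys :: "nat \<Rightarrow> (real \<times> real \<times> real \<Rightarrow> complex) set" where
  "param_polys M = fun_space.span (param_monom ` ({..M} \<times> {..M} \<times> {..M}))"

lemma param_polys_mono: "M \<le> N \<Longrightarrow> param_polys M \<subseteq> param_polys N"
  unfolding param_polys_def by (intro fun_space.span_mono image_mono) auto

lemma param_polys_monom: "i \<le> M \<Longrightarrow> j \<le> M \<Longrightarrow> k \<le> M \<Longrightarrow> param_monom (i, j, k) \<in> param_polys M"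
  unfolding param_polys_def by (rule fun_space.span_base) auto

lemma param_polys_add: "g \<in> param_polys M \<Longrightarrow> h \<in> param_polys M \<Longrightarrow> (\<lambda>x. g x + h x) \<in> param_polys M"
  using fun_space.span_add[of g _ h] unfolding param_polys_def plus_fun_def .

lemma param_polys_scale: "g \<in> param_polys M \<Longrightarrow> (\<lambda>x. c * g x) \<in> param_polys M"
  unfolding param_polys_def by (rule fun_space.span_scale)

lemma param_polys_zero: "(\<lambda>x. 0) \<in> param_polys M"
  using fun_space.span_zero unfolding param_polys_def zero_fun_def .

lemma param_polys_one: "(\<lambda>x. 1) \<in> param_polys M"
  using param_polys_monom[of 0 M 0 0] by (simp add: param_monom_def case_prod_unfold)

text \<open>Both spans are unfolded by bilinearity; the exponents of monomials add.\<close>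

lemma param_polys_mult:
  assumes "g \<in> param_polys M" "h \<in> param_polys N"
  shows "(\<lambda>x. g x * h x) \<in> param_polys (M + N)"
  using assms(1) unfolding param_polys_def[of M]
proof (induction rule: fun_space.span_induct_alt)
  case base
  then show ?case by (simp add: param_polys_zero)
next
  case (step c v g)
  have "(\<lambda>x. v x * h x) \<in> param_polys (M + N)"
    using assms(2) unfolding param_polys_def[of N]
  proof (induction rule: fun_space.span_induct_alt)
    case base
    then show ?case by (simp add: param_polys_zero)
  next
    case (step c' w h)
    obtain i j k i' j' k' where v: "v = param_monom (i, j, k)" "i \<le> M" "j \<le> M" "k \<le> M"
      and w: "w = param_monom (i', j', k')" "i' \<le> N" "j' \<le> N" "k' \<le> N"
      using \<open>v \<in> _\<close> \<open>w \<in> _\<close> by auto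
    have "(\<lambda>x. v x * w x) = param_monom (i + i', j + j', k + k')"
      by (auto simp: v w param_monom_def power_add)
    then have "(\<lambda>x. v x * w x) \<in> param_polys (M + N)"
      using v w by (simp add: param_polys_monom)
    then have "(\<lambda>x. c' * (v x * w x) + v x * h x) \<in> param_polys (M + N)"
      by (intro param_polys_add param_polys_scale step.IH)
    then show ?case by (simp add: algebra_simps)
  qed
  then have "(\<lambda>x. c * (v x * h x) + g x * h x) \<in> param_polys (M + N)"
    by (intro param_polys_add param_polys_scale step.IH)
  then show ?case by (simp add: algebra_simps)
qed

lemma param_polys_power: "g \<in> param_polys M \<Longrightarrow> (\<lambda>x. g x ^ n) \<in> param_polys (n * M)"
  by (induction n) (auto intro: param_polys_one param_polys_mult)

lemma odeco_param_in_param_polys: "\<exists>M. (\<lambda>x. odeco_param d x i) \<in> param_polys M"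
proof (cases "i \<le> d")
  case True
  have "(\<lambda>x. param_monom (1, 0, i) x + (- 1) ^ i * param_monom (0, 1, d - i) x) \<in> param_polys (Suc d)"
    using True by (intro param_polys_add param_polys_scale param_polys_monom) auto
  also have "(\<lambda>x. param_monom (1, 0, i) x + (- 1) ^ i * param_monom (0, 1, d - i) x) = (\<lambda>x. odeco_param d x i)"
  proof
    fix x :: "real \<times> real \<times> real"
    show "param_monom (1, 0, i) x + (- 1) ^ i * param_monom (0, 1, d - i) x = odeco_param d x i"
      using True by (cases x) (simp add: param_monom_def odeco_param_def)
  qed
  finally show ?thesis by blast
next
  case False
  then have "(\<lambda>x. odeco_param d x i) = (\<lambda>x. 0)" by (auto simp: odeco_param_def)
  then show ?thesis using param_polys_zero by metis
qed

lemma eval_monom_in_param_polys: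
  assumes "finite A"
  shows "\<exists>M. (\<lambda>x. \<Prod>i\<in>A. odeco_param d x i ^ e i) \<in> param_polys M"
  using assms
proof (induction A)
  case empty
  then show ?case using param_polys_one by simp
next
  case (insert i A)
  then obtain M where M: "(\<lambda>x. \<Prod>i\<in>A. odeco_param d x i ^ e i) \<in> param_polys M" by blast
  obtain N where "(\<lambda>x. odeco_param d x i) \<in> param_polys N" using odeco_param_in_param_polys by blast
  then have "(\<lambda>x. odeco_param d x i ^ e i * (\<Prod>i\<in>A. odeco_param d x i ^ e i)) \<in> param_polys (e i * N + M)"
    by (intro param_polys_mult param_polys_power M)
  then show ?case using insert.hyps by auto
qed

lemma eval_mpoly_in_param_polys: "\<exists>M. (\<lambda>x. eval_mpoly p (odeco_param d x)) \<in> param_polys M"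
proof -
  have "\<exists>M. (\<lambda>x. \<Sum>m\<in>A. Poly_Mapping.lookup p m * eval_monom m (odeco_param d x)) \<in> param_polys M"
    if "finite A" for A
    using that
  proof (induction A)
    case empty
    then show ?case using param_polys_zero by simp
  next
    case (insert m A)
    then obtain M where M: "(\<lambda>x. \<Sum>m\<in>A. Poly_Mapping.lookup p m * eval_monom m (odeco_param d x)) \<in> param_polys M"
      by blast
    obtain N where N: "(\<lambda>x. eval_monom m (odeco_param d x)) \<in> param_polys N"
      using eval_monom_in_param_polys[of "Poly_Mapping.keys m" d] unfolding eval_monom_def by auto
    have "(\<lambda>x. Poly_Mapping.lookup p m * eval_monom m (odeco_param d x) +
        (\<Sum>m\<in>A. Poly_Mapping.lookup p m * eval_monom m (odeco_param d x))) \<in> param_polys (max M N)"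
      using M N param_polys_mono[of M "max M N"] param_polys_mono[of N "max M N"]
      by (intro param_polys_add param_polys_scale) auto
    then show ?case using insert.hyps by auto
  qed
  then show ?thesis unfolding eval_mpoly_def by simp
qed

text \<open>For fixed length and \<open>D\<close> the degree bound is linear in \<open>n\<close>, so
  the spanning set grows only like \<open>n^3\<close>.\<close>

lemma power_product_in_param_polys:
  assumes "\<And>k. k < length l \<Longrightarrow> (\<lambda>x. eval_mpoly (f k) (odeco_param d x)) \<in> param_polys D"
    and "set l \<subseteq> {..<n}"
  shows "(\<lambda>x. eval_mpoly (power_product f l) (odeco_param d x)) \<in> param_polys (length l * n * D)"
  using assms
proof (induction l)
  case Nil
  then show ?case by (simp add: param_polys_one)
next
  case (Cons j l)
  have "(\<lambda>x. eval_mpoly (f (length l)) (odeco_param d x) ^ j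
      * eval_mpoly (power_product f l) (odeco_param d x)) \<in> param_polys (j * D + length l * n * D)"
    using Cons by (intro param_polys_mult param_polys_power Cons.IH) auto
  moreover have "j * D \<le> n * D" using Cons.prems(2) by (intro mult_right_mono) auto
  then have "j * D + length l * n * D \<le> length (j # l) * n * D" by (simp add: algebra_simps)
  ultimately show ?case using param_polys_mono by auto
qed

text \<open>A chain of length four yields \<open>n\<^sup>4\<close> products that are independent modulo \<open>I\<close>, but through the
  parametrization they live in a space of dimension \<open>O(n\<^sup>3)\<close>.\<close>

lemma not_irr_chain_4:
  assumes "d \<ge> 1"
  shows "\<not> irr_chain d (zero_set d (ideal_gen d (gens d))) 4"
proof
  let ?V = "zero_set d (ideal_gen d (gens d))"
  assume "irr_chain d ?V 4"
  then obtain Z where Z: "\<And>k. k \<le> 4 \<Longrightarrow> irreducible_closed d (Z k) \<and> Z k \<subseteq> ?V"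
    "\<And>k. k < 4 \<Longrightarrow> Z k \<subset> Z (Suc k)"
    unfolding irr_chain_def by blast
  \<comment> \<open>A point of \<open>Z (Suc k)\<close> outside the closed set \<open>Z k\<close>
    violates one of its equations.\<close>
  have "\<exists>f\<in>polyring d. (\<forall>x\<in>Z k. eval_mpoly f x = 0) \<and> \<not> (\<forall>x\<in>Z (Suc k). eval_mpoly f x = 0)"
    if k: "k < 4" for k
  proof -
    obtain S where S: "S \<subseteq> polyring d" "Z k = zero_set d S"
      using Z(1)[of k] k unfolding irreducible_closed_def zariski_closed_def by auto
    obtain x where x: "x \<in> Z (Suc k)" "x \<notin> Z k" using Z(2)[OF k] by blast
    have "x \<in> aspace d" using x Z(1)[of "Suc k"] k by (auto simp: zero_set_def)
    then obtain f where "f \<in> S" "eval_mpoly f x \<noteq> 0" using x S by (auto simp: zero_set_def)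
    then show ?thesis using S x by (intro bexI[of _ f]) (auto simp: zero_set_def)
  qed
  then obtain f where f: "\<And>k. k < 4 \<Longrightarrow> f k \<in> polyring d \<and> (\<forall>x\<in>Z k. eval_mpoly (f k) x = 0) \<and>
      \<not> (\<forall>x\<in>Z (Suc k). eval_mpoly (f k) x = 0)"
    by metis
  have "\<forall>k. \<exists>M. (\<lambda>x. eval_mpoly (f k) (odeco_param d x)) \<in> param_polys M"
    using eval_mpoly_in_param_polys by blast
  then obtain Df where Df: "\<And>k. (\<lambda>x. eval_mpoly (f k) (odeco_param d x)) \<in> param_polys (Df k)" by metis
  define D where "D = (\<Sum>k<4. Df k)"
  have D: "(\<lambda>x. eval_mpoly (f k) (odeco_param d x)) \<in> param_polys D" if "k < 4" for k
  proof -
    have "Df k \<le> D" unfolding D_def using that by (intro member_le_sum) auto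
    then show ?thesis using Df param_polys_mono by blast
  qed
  \<comment> \<open>The choice \<open>n > (4 * D + 1)^3\<close> gives
    \<open>(4 * n * D + 1)^3 <= n^3 * (4 * D + 1)^3 < n^4\<close>.\<close>
  define n where "n = Suc ((4 * D + 1) ^ 3)"
  define B where "B = {..4 * n * D} \<times> {..4 * n * D} \<times> {..4 * n * D}"
  have "card (param_monom ` B) \<le> card B" by (rule card_image_le) (simp add: B_def)
  also have "card B = (4 * n * D + 1) ^ 3" by (simp add: B_def card_cartesian_product power3_eq_cube)
  also have "\<dots> \<le> (n * (4 * D + 1)) ^ 3"
  proof (rule power_mono)
    have "1 \<le> n" by (simp add: n_def)
    then show "4 * n * D + 1 \<le> n * (4 * D + 1)" by (simp add: algebra_simps)
  qed simp
  also have "\<dots> = n ^ 3 * (4 * D + 1) ^ 3" by (rule power_mult_distrib)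
  also have "\<dots> < n ^ 3 * n"
    by (rule mult_strict_left_mono) (simp_all add: n_def)
  also have "n ^ 3 * n = n ^ 4" by (simp add: eval_nat_numeral)
  also have "\<dots> = card (exponents n 4)" by (simp add: card_exponents)
  finally have card: "card (param_monom ` B) < card (exponents n 4)" .
  have "(\<lambda>x. eval_mpoly (power_product f l) (odeco_param d x)) \<in> fun_space.span (param_monom ` B)"
    if "l \<in> exponents n 4" for l
    using power_product_in_param_polys[of l f d D n] D that
    by (simp add: exponents_def param_polys_def B_def)
  then obtain c where c: "\<exists>l\<in>exponents n 4. c l \<noteq> 0"
    "\<And>x. (\<Sum>l\<in>exponents n 4. c l * eval_mpoly (power_product f l) (odeco_param d x)) = 0"
    using linear_dependence[OF finite_exponents _ card,
        of "\<lambda>l x. eval_mpoly (power_product f l) (odeco_param d x)"] by (auto simp: B_def)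
  define P where "P = (\<Sum>l\<in>exponents n 4. Poly_Mapping.single 0 (c l) * power_product f l)"
  have "P \<in> polyring d"
    unfolding P_def using f
    by (intro polyring_sum polyring_mult polyring_const polyring_power_product) (auto simp: exponents_def)
  \<comment> \<open>The relation holds only on the parametrized tensors so far; membership in the
    ideal carries it to the whole variety and thus to \<open>Z 4\<close>.\<close>
  then have "P \<in> ideal_gen d (gens d)"
    unfolding ideal_gens_eq_vanishing[OF assms]
    using c(2) by (auto simp: vanishing_ideal_def odeco_tensors_eq P_def)
  then have "\<forall>x\<in>Z 4. eval_mpoly P x = 0" using Z(1)[of 4] by (auto simp: zero_set_def)
  then have "\<forall>x\<in>Z 4. (\<Sum>l\<in>exponents n 4. c l * eval_mpoly (power_product f l) x) = 0"
    by (simp add: P_def)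
  moreover have "Z 0 \<noteq> {}" using Z(1)[of 0] by (simp add: irreducible_closed_def)
  moreover have "Z k \<subseteq> Z (Suc k) \<and> irred_on d (Z (Suc k)) \<and> f k \<in> polyring d \<and>
      (\<forall>x\<in>Z k. eval_mpoly (f k) x = 0) \<and> \<not> (\<forall>x\<in>Z (Suc k). eval_mpoly (f k) x = 0)" if "k < 4" for k
    using f[OF that] Z(2)[OF that] Z(1)[of "Suc k"] that irreducible_closed_imp_irred_on by auto
  ultimately have "\<forall>l\<in>exponents n 4. c l = 0"
    by (intro chain_power_products_independent[where Z = Z and f = f and d = d]) auto
  then show False using c(1) by blast
qed

theorem theorem3p6:
  fixes d :: nat
  assumes "d \<ge> 2"
  shows "groebner_basis (gens d) (ideal_gen d (gens d))
         \<and> has_dim d (zero_set d (ideal_gen d (gens d))) 3 \<and> 3 = (2 + 1 choose 2)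
         \<and> prime_ideal d (ideal_gen d (gens d))
         \<and> ideal_gen d (gens d) = vanishing_ideal d (odeco_variety d)"
proof -
  have d: "d \<ge> 1" using assms by simp
  have "has_dim d (zero_set d (ideal_gen d (gens d))) 3"
    unfolding has_dim_def using irr_chain_3[OF assms] not_irr_chain_4[OF d] by simp
  moreover have "(3 :: nat) = (2 + 1 choose 2)" by (simp add: choose_two)
  moreover have "ideal_gen d (gens d) = vanishing_ideal d (odeco_variety d)"
    unfolding odeco_variety_def vanishing_ideal_zariski_closure[OF odeco_tensors_subset_aspace]
    by (rule ideal_gens_eq_vanishing[OF d])
  moreover have "prime_ideal d (ideal_gen d (gens d))"
    unfolding ideal_gens_eq_vanishing[OF d] by (rule prime_ideal_vanishing_odeco)
  ultimately show ?thesis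
    using groebner_basis_gens[OF d] by blast
qed

end
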